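(* Let $X$ be a Banach space with property $(m_1^* )$ such that $B_{X^*}$ is weak$^*$-sequentially compact. Then $X^*$ has both the $1$-Schur property and the $1$-strong Schur property. The assumptions are satisfied, in particular, if $X$ is isometric to a subspace of $c_0(\Gamma)$ (for some set $\Gamma$).
   Context: Banach spaces are over $\mathbb F\in\{\mathbb R,\mathbb C\}$; $B_{X^*}$ is the closed unit ball of $X^*$. $X$ has property $(m_1^* )$ if $\limsup\|x_n^*+x^*\|=\|x^*\|+\limsup\|x_n^*\|$ whenever $x^*\in X^*$ and $(x_n^* )$ is a weak$^*$-null sequence in $X^*$. For a bounded sequence in a Banach space $Y$ put $\operatorname{ca}(y_n)=\inf_{n}\operatorname{diam}\{y_k: k\ge n\}$ (also for scalar sequences) and $\delta(y_n)=\sup\{\operatorname{ca}(y^*(y_n)): y^*\in B_{Y^*}\}$. $Y$ has the $1$-Schur property if $\operatorname{ca}(y_n)\le\delta(y_n)$ for each bounded sequence $(y_n)$ in $Y$. $Y$ has the $1$-strong Schur property if for any $\delta\in(0,2]$, any $\varepsilon>0$ and any normalized $\delta$-separated sequence in $Y$ (i.e. $\|y_n\|=1$ and $\|y_n-y_m\|\ge\delta$ for $n\neq m$) there is a subsequence which is $(\frac2\delta+\varepsilon)$-equivalent to the standard basis of $\ell_1$; a normalized sequence $(y_j)$ is $K$-equivalent to the standard basis of $\ell_1$ if $\frac1K\sum_{j=1}^m|\alpha_j|\le\|\sum_{j=1}^m\alpha_jy_j\|$ for all $m$ and $\alpha_1,\dots,\alpha_m\in\mathbb F$. *)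

theory Defs
  imports "HOL-Analysis.Analysis"
begin

section \<open>The scalar field\<close>

text \<open>A type of this class is a copy of the normed field of real or of complex numbers.\<close>

class real_or_complex = real_normed_field +
  assumes real_or_complex:
    "(\<exists>\<phi> :: 'a \<Rightarrow> real. bij \<phi> \<and> (\<forall>x y. \<phi> (x + y) = \<phi> x + \<phi> y) \<and>
        (\<forall>x y. \<phi> (x * y) = \<phi> x * \<phi> y) \<and> (\<forall>x. norm (\<phi> x) = norm x)) \<or>
     (\<exists>\<phi> :: 'a \<Rightarrow> complex. bij \<phi> \<and> (\<forall>x y. \<phi> (x + y) = \<phi> x + \<phi> y) \<and>
        (\<forall>x y. \<phi> (x * y) = \<phi> x * \<phi> y) \<and> (\<forall>x. norm (\<phi> x) = norm x))"

instance real :: real_or_complex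
  by standard (rule disjI1, rule exI[of _ id], simp)

instance complex :: real_or_complex
  by standard (rule disjI2, rule exI[of _ id], simp)


section \<open>Banach spaces over the scalar field and their duals\<close>

text \<open>
  The type class \<open>banach\<close> provides the underlying real Banach space; \<open>scl\<close> is the
  multiplication by scalars from \<open>'k\<close>, compatible with the real scalars and with the norm.
\<close>

locale banach_space_over = vector_space scl
  for scl :: "'k::real_or_complex \<Rightarrow> 'a::banach \<Rightarrow> 'a" +
  assumes scl_of_real: "scl (of_real r) x = r *\<^sub>R x"
    and norm_scl: "norm (scl c x) = norm c * norm x"

text \<open>
  The dual consists of the bounded real-linear maps into \<open>'k\<close> that are homogeneous over \<open>'k\<close>;
  it carries the operator norm of the type of bounded linear maps, and \<open>dual_scl\<close> as its
  scalar multiplication.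
\<close>

definition dual_space ::
    "('k::real_or_complex \<Rightarrow> 'a::real_normed_vector \<Rightarrow> 'a) \<Rightarrow> ('a \<Rightarrow>\<^sub>L 'k) set" where
  "dual_space scl = {f. \<forall>c x. blinfun_apply f (scl c x) = c * blinfun_apply f x}"

definition dual_scl :: "'k::real_or_complex \<Rightarrow> ('a::real_normed_vector \<Rightarrow>\<^sub>L 'k) \<Rightarrow> ('a \<Rightarrow>\<^sub>L 'k)" where
  "dual_scl c f = blinfun_mult_right c o\<^sub>L f"

lemma dual_scl_apply [simp]: "blinfun_apply (dual_scl c f) x = c * blinfun_apply f x"
  by (simp add: dual_scl_def)

definition dual_ball ::
    "('k::real_or_complex \<Rightarrow> 'a::real_normed_vector \<Rightarrow> 'a) \<Rightarrow> ('a \<Rightarrow>\<^sub>L 'k) set" where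
  "dual_ball scl = {f \<in> dual_space scl. norm f \<le> 1}"

text \<open>
  For maps into the scalar field, the strong operator topology (the initial topology of the
  evaluations at points) is the weak* topology.
\<close>

definition weak_star_topology ::
    "('k::real_or_complex \<Rightarrow> 'a::real_normed_vector \<Rightarrow> 'a) \<Rightarrow> ('a \<Rightarrow>\<^sub>L 'k) topology" where
  "weak_star_topology scl = subtopology strong_operator_topology (dual_space scl)"

definition seq_compactin :: "'a topology \<Rightarrow> 'a set \<Rightarrow> bool" where
  "seq_compactin T S \<longleftrightarrow> (\<forall>\<sigma> :: nat \<Rightarrow> 'a. range \<sigma> \<subseteq> S \<longrightarrow>
     (\<exists>l\<in>S. \<exists>r. strict_mono r \<and> limitin T (\<sigma> \<circ> r) l sequentially))"

text \<open>The upper limits are taken in the extended reals, so no boundedness has to be assumed.\<close>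

definition property_m1_star ::
    "('k::real_or_complex \<Rightarrow> 'a::real_normed_vector \<Rightarrow> 'a) \<Rightarrow> bool" where
  "property_m1_star scl \<longleftrightarrow>
     (\<forall>f \<in> dual_space scl. \<forall>fs. range fs \<subseteq> dual_space scl \<longrightarrow>
        limitin (weak_star_topology scl) fs 0 sequentially \<longrightarrow>
        limsup (\<lambda>n. ereal (norm (fs n + f))) = ereal (norm f) + limsup (\<lambda>n. ereal (norm (fs n))))"


section \<open>Schur properties\<close>

text \<open>
  Here the Banach space is given as a subspace \<open>Y\<close> of a type, because the dual of a space over
  \<open>'k\<close> is a subspace of the type of bounded real-linear maps. The elements of the closed unit ball
  of the dual of \<open>Y\<close> are represented by functions whose values outside \<open>Y\<close> are irrelevant.
\<close>

definition functional_ball ::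
    "'b::real_normed_vector set \<Rightarrow> ('k::real_or_complex \<Rightarrow> 'b \<Rightarrow> 'b) \<Rightarrow> ('b \<Rightarrow> 'k) set" where
  "functional_ball Y scl = {g.
     (\<forall>x\<in>Y. \<forall>y\<in>Y. g (x + y) = g x + g y) \<and>
     (\<forall>c. \<forall>y\<in>Y. g (scl c y) = c * g y) \<and>
     (\<forall>y\<in>Y. norm (g y) \<le> norm y)}"

definition ca :: "(nat \<Rightarrow> 'b::metric_space) \<Rightarrow> real" where
  "ca y = (INF n. diameter (y ` {n..}))"

definition delta ::
    "'b::real_normed_vector set \<Rightarrow> ('k::real_or_complex \<Rightarrow> 'b \<Rightarrow> 'b) \<Rightarrow> (nat \<Rightarrow> 'b) \<Rightarrow> real" where
  "delta Y scl y = (SUP g \<in> functional_ball Y scl. ca (\<lambda>n. g (y n)))"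

definition one_Schur ::
    "'b::real_normed_vector set \<Rightarrow> ('k::real_or_complex \<Rightarrow> 'b \<Rightarrow> 'b) \<Rightarrow> bool" where
  "one_Schur Y scl \<longleftrightarrow>
     (\<forall>y :: nat \<Rightarrow> 'b. range y \<subseteq> Y \<longrightarrow> bounded (range y) \<longrightarrow> ca y \<le> delta Y scl y)"

definition equivalent_to_l1_basis ::
    "('k::real_or_complex \<Rightarrow> 'b::real_normed_vector \<Rightarrow> 'b) \<Rightarrow> real \<Rightarrow> (nat \<Rightarrow> 'b) \<Rightarrow> bool" where
  "equivalent_to_l1_basis scl K y \<longleftrightarrow> (\<forall>j. norm (y j) = 1) \<and>
     (\<forall>m. \<forall>\<alpha> :: nat \<Rightarrow> 'k.
        1 / K * (\<Sum>j<m. norm (\<alpha> j)) \<le> norm (\<Sum>j<m. scl (\<alpha> j) (y j)))"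

definition one_strong_Schur ::
    "'b::real_normed_vector set \<Rightarrow> ('k::real_or_complex \<Rightarrow> 'b \<Rightarrow> 'b) \<Rightarrow> bool" where
  "one_strong_Schur Y scl \<longleftrightarrow>
     (\<forall>\<delta>::real. \<forall>\<epsilon>::real. \<forall>y :: nat \<Rightarrow> 'b.
        0 < \<delta> \<longrightarrow> \<delta> \<le> 2 \<longrightarrow> 0 < \<epsilon> \<longrightarrow>
        range y \<subseteq> Y \<longrightarrow> (\<forall>n. norm (y n) = 1) \<longrightarrow>
        (\<forall>n m. n \<noteq> m \<longrightarrow> \<delta> \<le> norm (y n - y m)) \<longrightarrow>
        (\<exists>r. strict_mono r \<and> equivalent_to_l1_basis scl (2 / \<delta> + \<epsilon>) (y \<circ> r)))"


section \<open>Subspaces of the space of null families\<close>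

definition c0_space :: "'g set \<Rightarrow> ('g \<Rightarrow> 'k::real_or_complex) set" where
  "c0_space \<Gamma> = {f. (\<forall>\<gamma>. \<gamma> \<notin> \<Gamma> \<longrightarrow> f \<gamma> = 0) \<and> (\<forall>\<epsilon>>0. finite {\<gamma>\<in>\<Gamma>. \<epsilon> \<le> norm (f \<gamma>)})}"

text \<open>The supremum norm; the element 0 is inserted only for the case of an empty index set.\<close>

definition c0_norm :: "'g set \<Rightarrow> ('g \<Rightarrow> 'k::real_or_complex) \<Rightarrow> real" where
  "c0_norm \<Gamma> f = Sup (insert 0 ((\<lambda>\<gamma>. norm (f \<gamma>)) ` \<Gamma>))"

text \<open>Isometric means linearly isometric: the range of the embedding \<open>T\<close> is the subspace.\<close>

definition isometric_to_subspace_c0 ::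
    "('k::real_or_complex \<Rightarrow> 'a::real_normed_vector \<Rightarrow> 'a) \<Rightarrow> 'g set \<Rightarrow> bool" where
  "isometric_to_subspace_c0 scl \<Gamma> \<longleftrightarrow>
     (\<exists>T :: 'a \<Rightarrow> 'g \<Rightarrow> 'k.
        range T \<subseteq> c0_space \<Gamma> \<and>
        (\<forall>x y. T (x + y) = (\<lambda>\<gamma>. T x \<gamma> + T y \<gamma>)) \<and>
        (\<forall>c x. T (scl c x) = (\<lambda>\<gamma>. c * T x \<gamma>)) \<and>
        (\<forall>x. c0_norm \<Gamma> (T x) = norm x))"

end

theory Submission
  imports Defs "HOL-Probability.Discrete_Topology"
begin

text \<open>
  The key fact is that property \<open>m\<^sub>1\<^sup>*\<close> makes weak* null sequences behave like the basis of
  \<open>\<ell>\<^sub>1\<close>, jointly with any fixed functional. If \<open>t n\<close> is bounded and weak* null, then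
  \<open>norm (w + t n) - norm w - norm (t n)\<close> tends to 0 for each functional \<open>w\<close>, uniformly on compact sets. An
  inductive choice of indices yields a subsequence for which, up to a prescribed additive error, the
  norm of \<open>b d + \<beta> 0 t 0 + \<dots> + \<beta> (m - 1) t (m - 1)\<close> is the weighted sum of the norms, for all \<open>m\<close> and
  all coefficients in the unit disc (\<open>almost_l1_subsequence\<close>).

  A separated normalized sequence \<open>y\<close> in the dual has a subsequence with a weak* limit \<open>d\<close>. By the
  triangle inequality, all but at most one of the differences \<open>y n - d\<close> have norm at least \<open>\<delta>/2\<close>, and the
  strong Schur property follows by applying the extraction to these differences.

  For the Schur property, let \<open>z n\<close> be differences of far terms of \<open>y\<close>, with weak* limit \<open>d\<close> along a
  subsequence. After extraction, the norm of \<open>d + t 0 + \<dots> + t (m - 1)\<close>, where \<open>t k = z k - d\<close>, is nearly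
  the sum of the norms. So a point of the unit ball of \<open>X\<close> that almost norms this sum almost norms
  \<open>d\<close> and each \<open>t k\<close> in the same direction, and hence is nearly as large on \<open>z k = d + t k\<close> as its norm
  for all \<open>k < m\<close>. A pointwise cluster point of these evaluations, as \<open>m\<close> grows, is a functional on the dual that
  separates the far terms (\<open>common_norming_functional\<close>); no extension theorem is needed here.

  If \<open>X\<close> embeds isometrically into \<open>c\<^sub>0(\<Gamma>)\<close>, the Hahn-Banach theorem represents each functional by an absolutely
  summable family whose total mass is at most its norm (\<open>representation\<close>). Only countably many indices matter
  for a sequence of functionals, so a subsequence of the families converges coordinatewise, which
  gives weak* convergence of the functionals (\<open>represents_subseq\<close>). Applied to \<open>f + t n\<close> with \<open>t\<close>
  weak* null, this shows asymptotic additivity: the mass of the family for \<open>f + t n\<close> splits into a part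
  close to a family for \<open>f\<close> and a part that bounds the norm of \<open>t n\<close> (\<open>represents_diff_bound\<close>).
\<close>

section \<open>Scalars\<close>

text \<open>Treating the scalar field as a closed subfield of the complex numbers gives both cases at once.\<close>

lemma embed_complex:
  obtains \<psi> :: "'k::real_or_complex \<Rightarrow> complex" where
    "linear \<psi>" "\<And>x y. \<psi> (x * y) = \<psi> x * \<psi> y" "\<And>x. norm (\<psi> x) = norm x" "\<psi> 1 = 1"
    "range \<psi> = UNIV \<or> range \<psi> = \<real>"
proof -
  have ex: "\<exists>\<psi> :: 'k \<Rightarrow> complex. (\<forall>x y. \<psi> (x + y) = \<psi> x + \<psi> y) \<and>
        (\<forall>x y. \<psi> (x * y) = \<psi> x * \<psi> y) \<and> (\<forall>x. norm (\<psi> x) = norm x) \<and>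
        (range \<psi> = UNIV \<or> range \<psi> = \<real>)"
    using real_or_complex[where 'a='k]
  proof (elim disjE exE conjE)
    fix \<phi> :: "'k \<Rightarrow> real"
    assume \<phi>: "bij \<phi>" "\<forall>x y. \<phi> (x + y) = \<phi> x + \<phi> y"
      "\<forall>x y. \<phi> (x * y) = \<phi> x * \<phi> y" "\<forall>x. norm (\<phi> x) = norm x"
    have "range (\<lambda>x. complex_of_real (\<phi> x)) = complex_of_real ` range \<phi>" by auto
    also have "\<dots> = \<real>" using \<phi>(1) by (simp add: bij_def Reals_def)
    finally show ?thesis
      using \<phi> by (intro exI[of _ "\<lambda>x. complex_of_real (\<phi> x)"]) (simp_all add: norm_of_real)
  next
    fix \<phi> :: "'k \<Rightarrow> complex"
    assume \<phi>: "bij \<phi>" "\<forall>x y. \<phi> (x + y) = \<phi> x + \<phi> y"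
      "\<forall>x y. \<phi> (x * y) = \<phi> x * \<phi> y" "\<forall>x. norm (\<phi> x) = norm x"
    then show ?thesis by (intro exI[of _ \<phi>]) (auto simp: bij_def)
  qed
  then obtain \<psi> :: "'k \<Rightarrow> complex" where add: "\<And>x y. \<psi> (x + y) = \<psi> x + \<psi> y"
    and mult: "\<And>x y. \<psi> (x * y) = \<psi> x * \<psi> y" and nrm: "\<And>x. norm (\<psi> x) = norm x"
    and rng: "range \<psi> = UNIV \<or> range \<psi> = \<real>" by blast
  have "\<psi> 1 \<noteq> 0" using nrm[of 1] by auto
  then have one: "\<psi> 1 = 1" using mult[of 1 1] by simp
  have diff: "\<psi> (x - y) = \<psi> x - \<psi> y" for x y using add[of "x - y" y] by simp
  \<comment> \<open>The image of a real number is determined by its distances to 0 and 1.\<close>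
  have ofr: "\<psi> (of_real r) = of_real r" for r
  proof -
    let ?c = "\<psi> (of_real r)"
    have "norm ?c = \<bar>r\<bar>" by (simp add: nrm)
    moreover have "norm (?c - 1) = \<bar>r - 1\<bar>"
      using nrm[of "of_real r - 1"] norm_of_real[of "r - 1", where 'a='k] by (simp add: diff one)
    ultimately have e: "(norm ?c)\<^sup>2 = r\<^sup>2" "(norm (?c - 1))\<^sup>2 = (r - 1)\<^sup>2" by simp_all
    then have "Re ?c = r" unfolding cmod_power2 by (simp add: power2_eq_square algebra_simps)
    with e(1) have "Im ?c = 0" by (simp add: cmod_power2)
    with \<open>Re ?c = r\<close> show ?thesis by (simp add: complex_eq_iff)
  qed
  have "linear \<psi>"
  proof
    show "\<psi> (r *\<^sub>R x) = r *\<^sub>R \<psi> x" for r x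
      using mult[of "of_real r" x] ofr[of r] by (simp add: scaleR_conv_of_real)
  qed (rule add)
  from that[OF this mult nrm one rng] show ?thesis .
qed

lemma real_part_exists:
  "\<exists>\<rho> :: 'k::real_or_complex \<Rightarrow> real. linear \<rho> \<and> (\<forall>z. \<bar>\<rho> z\<bar> \<le> norm z) \<and> \<rho> 1 = 1 \<and>
     (\<forall>l. linear l \<longrightarrow> (\<exists>a. \<forall>z. l z = \<rho> (a * z)))"
proof -
  obtain \<psi> :: "'k \<Rightarrow> complex" where lin: "linear \<psi>" and mult: "\<And>x y. \<psi> (x * y) = \<psi> x * \<psi> y"
    and nrm: "\<And>x. norm (\<psi> x) = norm x" and one: "\<psi> 1 = 1"
    and rng: "range \<psi> = UNIV \<or> range \<psi> = \<real>" by (rule embed_complex) blast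
  have inj: "inj \<psi>"
    using nrm linear_injective_0[OF lin] by (metis norm_eq_zero)
  have linR: "linear (\<lambda>z. Re (\<psi> z))"
    using linear_compose[OF lin bounded_linear.linear[OF bounded_linear_Re]] by (simp add: o_def)
  have riesz: "\<exists>a. \<forall>z. l z = Re (\<psi> (a * z))" if l: "linear l" for l :: "'k \<Rightarrow> real"
    using rng
  proof
    assume U: "range \<psi> = UNIV"
    then obtain i where i: "\<psi> i = \<i>" by (metis surj_def)
    obtain a where a: "\<psi> a = Complex (l 1) (- l i)" using U by (metis surj_def)
    have "l z = Re (\<psi> (a * z))" for z
    proof -
      have "\<psi> z = \<psi> (Re (\<psi> z) *\<^sub>R 1 + Im (\<psi> z) *\<^sub>R i)"
        by (simp add: linear_add[OF lin] linear_scale[OF lin] one i complex_eq_iff)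
      then have z: "z = Re (\<psi> z) *\<^sub>R 1 + Im (\<psi> z) *\<^sub>R i" using inj by (simp add: inj_eq)
      show ?thesis
        by (subst z) (simp add: linear_add[OF l] linear_scale[OF l] mult a)
    qed
    then show ?thesis by blast
  next
    assume R: "range \<psi> = \<real>"
    have "l z = Re (\<psi> (of_real (l 1) * z))" for z
    proof -
      have "\<psi> z \<in> \<real>" using R by blast
      then have "\<psi> z = \<psi> (Re (\<psi> z) *\<^sub>R 1)"
        by (simp add: linear_scale[OF lin] one complex_is_Real_iff complex_eq_iff)
      then have z: "z = Re (\<psi> z) *\<^sub>R 1" using inj by (simp add: inj_eq)
      have "l z = Re (\<psi> z) * l 1" by (subst z) (simp add: linear_scale[OF l])
      then show ?thesis by (simp add: scaleR_conv_of_real[symmetric] linear_scale[OF lin])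
    qed
    then show ?thesis by blast
  qed
  show ?thesis
    by (rule exI[of _ "\<lambda>z. Re (\<psi> z)"]) (use linR riesz one nrm in \<open>auto intro: order_trans[OF abs_Re_le_cmod]\<close>)
qed

text \<open>
  The scalar field is only known up to isomorphism, so a real part is chosen by its properties: it is
  real-linear, bounded by the norm and normalized at 1, and its multiples are all real-linear
  functionals (\<open>real_part_riesz\<close>).
\<close>

definition real_part :: "'k::real_or_complex \<Rightarrow> real" where
  "real_part = (SOME \<rho>. linear \<rho> \<and> (\<forall>z. \<bar>\<rho> z\<bar> \<le> norm z) \<and> \<rho> 1 = 1 \<and>
     (\<forall>l. linear l \<longrightarrow> (\<exists>a. \<forall>z. l z = \<rho> (a * z))))"

lemma linear_real_part: "linear real_part"
  and abs_real_part_le: "\<bar>real_part z\<bar> \<le> norm z"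
  and real_part_one [simp]: "real_part 1 = 1"
  and real_part_riesz: "linear l \<Longrightarrow> \<exists>a. \<forall>z. l z = real_part (a * z)"
  using someI_ex[OF real_part_exists] unfolding real_part_def[symmetric] by blast+

lemma real_part_le: "real_part z \<le> norm z"
  using abs_real_part_le[of z] by linarith

lemmas real_part_add = linear_add[OF linear_real_part]
  and real_part_diff = linear_diff[OF linear_real_part]
  and real_part_sum = linear_sum[OF linear_real_part]
  and real_part_scaleR = linear_scale[OF linear_real_part]

lemma real_part_0 [simp]: "real_part 0 = 0"
  by (rule linear_0[OF linear_real_part])

lemma real_part_of_real [simp]: "real_part (of_real r) = r"
  by (simp add: of_real_def real_part_scaleR)

lemma continuous_on_real_part: "continuous_on S real_part"
proof -
  have "bounded_linear real_part"
    by (rule bounded_linear_intro[of _ 1])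
      (simp_all add: real_part_add real_part_scaleR abs_real_part_le)
  then show ?thesis by (rule linear_continuous_on)
qed

lemma compact_cball_scalar: "compact (cball (0::'k::real_or_complex) r)"
proof -
  obtain \<psi> :: "'k \<Rightarrow> complex" where lin: "linear \<psi>"
    and nrm: "\<And>x. norm (\<psi> x) = norm x" and rng: "range \<psi> = UNIV \<or> range \<psi> = \<real>"
    by (rule embed_complex) blast
  have inj: "inj \<psi>"
    using nrm linear_injective_0[OF lin] by (metis norm_eq_zero)
  have iso: "dist (inv \<psi> u) (inv \<psi> v) = dist u v" if "u \<in> range \<psi>" "v \<in> range \<psi>" for u v
    using that nrm by (auto simp: inj dist_norm linear_diff[OF lin, symmetric])
  have "closed (range \<psi>)" using rng closed_complex_Reals by auto
  then have "compact (cball 0 r \<inter> range \<psi>)" by (intro compact_Int_closed compact_cball)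
  moreover have "continuous_on (cball 0 r \<inter> range \<psi>) (inv \<psi>)"
    unfolding continuous_on_iff using iso by (metis IntD2)
  ultimately have "compact (inv \<psi> ` (cball 0 r \<inter> range \<psi>))" by (intro compact_continuous_image)
  moreover have "inv \<psi> ` (cball 0 r \<inter> range \<psi>) = cball 0 r"
  proof (intro equalityI subsetI)
    fix x :: 'k assume "x \<in> cball 0 r"
    then show "x \<in> inv \<psi> ` (cball 0 r \<inter> range \<psi>)"
      using nrm by (intro image_eqI[of _ _ "\<psi> x"]) (simp_all add: inj)
  qed (use nrm in \<open>auto simp: inj\<close>)
  ultimately show ?thesis by simp
qed

text \<open>Polar decomposition, with a unimodular factor also for \<open>a = 0\<close>.\<close>

lemma sgn_scalar:
  fixes a :: "'k::real_normed_field"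
  obtains \<theta> where "norm \<theta> = 1" "a = of_real (norm a) * \<theta>" "\<theta> \<noteq> 0"
proof (cases "a = 0")
  case True then show ?thesis using that[of 1] by simp
next
  case False
  show ?thesis
    by (rule that[of "sgn a"]) (use False in \<open>simp_all add: norm_sgn sgn_zero_iff, simp add: sgn_div_norm scaleR_conv_of_real\<close>)
qed

section \<open>Asymptotically additive sequences\<close>

text \<open>A normed space over the scalar field. Completeness is not needed in this section.\<close>

locale normed_space_over = vector_space s
  for s :: "'k::real_or_complex \<Rightarrow> 'b::real_normed_vector \<Rightarrow> 'b" +
  assumes norm_scale: "norm (s c x) = norm c * norm x"
begin

lemma continuous_on_scale: "continuous_on S (\<lambda>c. s c x)"
proof -
  have "dist (s c x) (s d x) \<le> norm x * dist c d" for c d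
    by (simp add: dist_norm norm_scale scale_left_diff_distrib[symmetric])
  then have "(norm x)-lipschitz_on S (\<lambda>c. s c x)" by (simp add: lipschitz_on_def)
  then show ?thesis by (rule lipschitz_on_continuous_on)
qed

text \<open>
  The combinations of \<open>d\<close> and the first \<open>p\<close> terms of \<open>t\<close> with coefficients in the closed unit disc.
\<close>

primrec disc_comb :: "'b \<Rightarrow> (nat \<Rightarrow> 'b) \<Rightarrow> nat \<Rightarrow> 'b set" where
  "disc_comb d t 0 = (\<lambda>c. s c d) ` cball 0 1"
| "disc_comb d t (Suc p) = {w + v | w v. w \<in> disc_comb d t p \<and> v \<in> (\<lambda>c. s c (t p)) ` cball 0 1}"

lemma compact_disc_comb: "compact (disc_comb d t p)"
proof -
  have c: "compact ((\<lambda>c. s c v) ` cball 0 1)" for v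
    by (intro compact_continuous_image continuous_on_scale compact_cball_scalar)
  show ?thesis by (induction p) (auto intro!: c compact_sums)
qed

lemma disc_comb_Suc_mono: "disc_comb d t p \<subseteq> disc_comb d t (Suc p)"
proof
  fix w assume w: "w \<in> disc_comb d t p"
  have "s 0 (t p) \<in> (\<lambda>c. s c (t p)) ` cball 0 1" by (rule imageI) simp
  with w show "w \<in> disc_comb d t (Suc p)" by force
qed

lemma disc_comb_mono: "p \<le> q \<Longrightarrow> disc_comb d t p \<subseteq> disc_comb d t q"
  by (rule lift_Suc_mono_le[where f = "disc_comb d t", OF disc_comb_Suc_mono])

lemma disc_comb_balanced:
  assumes "norm c \<le> 1" "w \<in> disc_comb d t p"
  shows "s c w \<in> disc_comb d t p"
  using assms(2)
proof (induction p arbitrary: w)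
  case 0
  then obtain b where "w = s b d" "b \<in> cball 0 1" unfolding disc_comb.simps by (rule imageE)
  then show ?case using assms(1) by (auto simp: norm_mult intro!: image_eqI[of _ _ "c * b"] mult_le_one)
next
  case (Suc p)
  then obtain v b where "w = v + s b (t p)" "v \<in> disc_comb d t p" "norm b \<le> 1" by auto
  moreover from this have "s c v \<in> disc_comb d t p" by (intro Suc.IH)
  moreover have "s c (s b (t p)) \<in> (\<lambda>c. s c (t p)) ` cball 0 1"
    using assms(1) \<open>norm b \<le> 1\<close> by (auto simp: norm_mult intro!: image_eqI[of _ _ "c * b"] mult_le_one)
  ultimately show ?case by (auto simp: scale_right_distrib)
qed

lemma disc_comb_subset:
  assumes "subspace D" "d \<in> D" "\<And>n. t n \<in> D"
  shows "disc_comb d t p \<subseteq> D"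
  by (induction p) (use assms in \<open>auto intro!: subspace_add subspace_scale\<close>)

end

text \<open>The norm is Lipschitz, so pointwise asymptotic additivity is uniform on compact sets.\<close>

lemma asymp_additive_compact:
  fixes t :: "nat \<Rightarrow> 'b::real_normed_vector"
  assumes W: "compact W" and \<epsilon>: "\<epsilon> > 0"
    and ev: "\<And>w e. w \<in> W \<Longrightarrow> e > 0 \<Longrightarrow> \<forall>\<^sub>F n in sequentially. norm w + norm (t n) - e \<le> norm (w + t n)"
  shows "\<forall>\<^sub>F n in sequentially. \<forall>w\<in>W. norm w + norm (t n) - \<epsilon> \<le> norm (w + t n)"
proof -
  obtain K where K: "finite K" "K \<subseteq> W" "W \<subseteq> (\<Union>x\<in>K. ball x (\<epsilon>/3))"
    using seq_compact_imp_totally_bounded[of W] W \<epsilon> unfolding compact_eq_seq_compact_metric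
    by (meson divide_pos_pos zero_less_numeral)
  have "\<forall>\<^sub>F n in sequentially. \<forall>x\<in>K. norm x + norm (t n) - \<epsilon>/3 \<le> norm (x + t n)"
    using K \<epsilon> by (intro eventually_ball_finite) (auto intro!: ev)
  then show ?thesis
  proof eventually_elim
    case (elim n)
    show ?case
    proof
      fix w assume "w \<in> W"
      then obtain x where x: "x \<in> K" "dist x w < \<epsilon>/3" using K(3) by auto
      have "norm w \<le> norm x + norm (w - x)" by (metis norm_triangle_sub add.commute)
      moreover have "norm (x + t n) \<le> norm (w + t n) + norm (x - w)"
        using norm_triangle_ineq[of "w + t n" "x - w"] by (simp add: algebra_simps)
      ultimately show "norm w + norm (t n) - \<epsilon> \<le> norm (w + t n)"
        using elim[rule_format, OF x(1)] x(2) by (simp add: dist_norm norm_minus_commute)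
    qed
  qed
qed

context normed_space_over
begin

text \<open>
  The factor \<open>c\<close> is replaced by the unimodular \<open>\<theta>\<close> with \<open>c = norm c * \<theta>\<close>, which can be moved to \<open>w\<close>;
  the replacement changes the norm by at most \<open>(1 - norm c) * norm v\<close>.
\<close>

lemma almost_additive_scale:
  assumes bal: "\<And>c w. norm c \<le> 1 \<Longrightarrow> w \<in> W \<Longrightarrow> s c w \<in> W"
    and add: "\<And>w. w \<in> W \<Longrightarrow> norm w + norm v - \<epsilon> \<le> norm (w + v)"
    and c: "norm c \<le> 1" and w: "w \<in> W"
  shows "norm w + norm c * norm v - \<epsilon> \<le> norm (w + s c v)"
proof -
  obtain \<theta> where \<theta>: "norm \<theta> = 1" "c = of_real (norm c) * \<theta>" "\<theta> \<noteq> 0" by (rule sgn_scalar)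
  have "s (inverse \<theta>) w \<in> W" using \<theta> w by (intro bal) (simp_all add: norm_inverse)
  from add[OF this] have "norm w + norm v - \<epsilon> \<le> norm (s (inverse \<theta>) w + v)"
    using \<theta> by (simp add: norm_scale norm_inverse)
  also have "\<dots> = norm (s \<theta> (s (inverse \<theta>) w + v))" using \<theta> by (simp add: norm_scale)
  also have "s \<theta> (s (inverse \<theta>) w + v) = w + s \<theta> v" using \<theta> by (simp add: scale_right_distrib)
  also have "w + s \<theta> v = (w + s c v) + s (of_real (1 - norm c) * \<theta>) v"
    using \<theta>(2) by (simp add: left_diff_distrib scale_left_diff_distrib)
  also have "norm \<dots> \<le> norm (w + s c v) + norm (s (of_real (1 - norm c) * \<theta>) v)"
    by (rule norm_triangle_ineq)
  also have "norm (s (of_real (1 - norm c) * \<theta>) v) = (1 - norm c) * norm v"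
    using c \<theta>(1) norm_of_real[of "1 - norm c", where 'a='k] by (simp add: norm_scale norm_mult)
  finally show ?thesis by (simp add: algebra_simps)
qed

text \<open>
  Up to the additive error \<open>\<eta>\<close>, the norm of a combination of \<open>d, v 0, v 1, \<dots>\<close> with coefficients in
  the closed unit disc is the weighted sum of the norms.
\<close>

definition almost_l1 :: "'b \<Rightarrow> (nat \<Rightarrow> 'b) \<Rightarrow> real \<Rightarrow> bool" where
  "almost_l1 d v \<eta> \<longleftrightarrow> (\<forall>m b \<beta>. norm b \<le> 1 \<longrightarrow> (\<forall>k. norm (\<beta> k) \<le> 1) \<longrightarrow>
     norm b * norm d + (\<Sum>k<m. norm (\<beta> k) * norm (v k)) - \<eta> \<le> norm (s b d + (\<Sum>k<m. s (\<beta> k) (v k))))"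

text \<open>
  The extraction lemma. In the inductive choice of the indices, the errors form a geometric
  series with sum \<open>\<eta>\<close>; the coefficients stay in a compact set, so each step needs only finitely
  many conditions.
\<close>

lemma almost_l1_subsequence:
  assumes D: "subspace D" "d \<in> D" "\<And>n. t n \<in> D" and \<eta>: "\<eta> > 0"
    and ev: "\<And>w e. w \<in> D \<Longrightarrow> e > 0 \<Longrightarrow> \<forall>\<^sub>F n in sequentially. norm w + norm (t n) - e \<le> norm (w + t n)"
  obtains r :: "nat \<Rightarrow> nat" where "strict_mono r"
    "almost_l1 d (t \<circ> r) \<eta>"
proof -
  define good where "good p e n \<longleftrightarrow>
    (\<forall>w\<in>disc_comb d t p. norm w + norm (t n) - e \<le> norm (w + t n))" for p e n
  have good: "\<exists>n>N. good p e n" if "e > 0" for p e N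
  proof -
    have "\<forall>\<^sub>F n in sequentially. good p e n" unfolding good_def
      by (intro asymp_additive_compact compact_disc_comb ev that subsetD[OF disc_comb_subset[OF D]])
    then show ?thesis
      using eventually_gt_at_top[of N]
      by (metis (mono_tags, lifting) eventually_at_top_linorder max.cobounded1 max.cobounded2
          order_less_le_trans lessI)
  qed
  define e where "e k = \<eta> / 2 ^ Suc k" for k
  have e: "e k > 0" for k using \<eta> by (simp add: e_def)
  have "\<exists>r. \<forall>k. (k = 0 \<longrightarrow> good 0 (e 0) (r k)) \<and> (r k < r (Suc k) \<and> good (Suc (r k)) (e (Suc k)) (r (Suc k)))"
    by (rule dependent_nat_choice[where P = "\<lambda>k x. k = 0 \<longrightarrow> good 0 (e 0) x"
        and Q = "\<lambda>k x y. x < y \<and> good (Suc x) (e (Suc k)) y"]) (use good e in blast)+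
  then obtain r where r0: "good 0 (e 0) (r 0)" and r: "\<And>k. r k < r (Suc k)"
    and rS: "\<And>k. good (Suc (r k)) (e (Suc k)) (r (Suc k))" by blast
  \<comment> \<open>Sums of the first \<open>m\<close> chosen terms are combinations of the first \<open>q m\<close> terms of \<open>t\<close>.\<close>
  define q where "q m = (case m of 0 \<Rightarrow> 0 | Suc j \<Rightarrow> Suc (r j))" for m
  have q: "q m \<le> r m" "good (q m) (e m) (r m)" "q (Suc m) = Suc (r m)" for m
    using r0 r rS by (cases m; simp add: q_def Suc_le_eq)+
  have main: "s b d + (\<Sum>k<m. s (\<beta> k) (t (r k))) \<in> disc_comb d t (q m) \<and>
     norm b * norm d + (\<Sum>k<m. norm (\<beta> k) * norm (t (r k))) - \<eta> * (1 - 1 / 2 ^ m)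
         \<le> norm (s b d + (\<Sum>k<m. s (\<beta> k) (t (r k))))"
    if b: "norm b \<le> 1" and \<beta>: "\<And>k. norm (\<beta> k) \<le> 1" for m :: nat and b and \<beta> :: "nat \<Rightarrow> 'k"
  proof (induction m)
    case 0
    have "s b d \<in> (\<lambda>c. s c d) ` cball 0 1" using b by (intro imageI) simp
    then show ?case by (simp add: q_def norm_scale)
  next
    case (Suc m)
    let ?w = "s b d + (\<Sum>k<m. s (\<beta> k) (t (r k)))"
    have w: "?w \<in> disc_comb d t (q m)" using Suc.IH by blast
    have "?w \<in> disc_comb d t (r m)" using w disc_comb_mono[OF q(1)[of m]] by blast
    moreover have "s (\<beta> m) (t (r m)) \<in> (\<lambda>c. s c (t (r m))) ` cball 0 1"
      using \<beta> by (intro imageI) simp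
    ultimately have in': "?w + s (\<beta> m) (t (r m)) \<in> disc_comb d t (Suc (r m))"
      unfolding disc_comb.simps by blast
    have "norm ?w + norm (\<beta> m) * norm (t (r m)) - e m \<le> norm (?w + s (\<beta> m) (t (r m)))"
      using q(2)[of m] unfolding good_def
      by (intro almost_additive_scale[OF disc_comb_balanced _ \<beta> w]) auto
    moreover have "\<eta> * (1 - 1 / 2 ^ m) + e m = \<eta> * (1 - 1 / 2 ^ Suc m)"
      by (simp add: e_def field_simps)
    ultimately show ?case using Suc.IH in' unfolding q(3) by (simp add: add.assoc)
  qed
  show thesis
  proof (rule that)
    show "strict_mono r" using r by (rule strict_monoI_Suc)
    show "almost_l1 d (t \<circ> r) \<eta>" unfolding almost_l1_def
    proof (intro allI impI)
      fix m :: nat and b :: 'k and \<beta> :: "nat \<Rightarrow> 'k"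
      assume "norm b \<le> 1" "\<forall>k. norm (\<beta> k) \<le> 1"
      then have "norm b * norm d + (\<Sum>k<m. norm (\<beta> k) * norm (t (r k))) - \<eta> * (1 - 1 / 2 ^ m)
           \<le> norm (s b d + (\<Sum>k<m. s (\<beta> k) (t (r k))))" using main by blast
      moreover have "\<eta> * (1 - 1 / 2 ^ m) \<le> \<eta> * 1" using \<eta> by (intro mult_left_mono) auto
      ultimately show "norm b * norm d + (\<Sum>k<m. norm (\<beta> k) * norm ((t \<circ> r) k)) - \<eta>
           \<le> norm (s b d + (\<Sum>k<m. s (\<beta> k) ((t \<circ> r) k)))" by simp
    qed
  qed
qed

text \<open>The same estimate with coefficients of any size, in homogeneous form.\<close>

lemma almost_l1_homogeneous:
  fixes m :: nat
  assumes est: "almost_l1 d v \<eta>"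
    and b: "norm b \<le> (\<Sum>k<m. norm (\<alpha> k))"
  shows "norm b * norm d + (\<Sum>k<m. norm (\<alpha> k) * norm (v k)) - \<eta> * (\<Sum>k<m. norm (\<alpha> k))
     \<le> norm (s b d + (\<Sum>k<m. s (\<alpha> k) (v k)))"
proof (cases "(\<Sum>k<m. norm (\<alpha> k)) = 0")
  case True
  then have "\<forall>k\<in>{..<m}. norm (\<alpha> k) = 0"
    using sum_nonneg_eq_0_iff[of "{..<m}" "\<lambda>k. norm (\<alpha> k)"] by simp
  moreover have "b = 0" using b True by simp
  ultimately show ?thesis by simp
next
  case False
  define S where "S = (\<Sum>k<m. norm (\<alpha> k))"
  have S: "S > 0" using False by (simp add: S_def sum_nonneg less_le)
  define \<beta> where "\<beta> k = (if k < m then \<alpha> k / of_real S else 0)" for k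
  have "norm (\<alpha> k) \<le> S" if "k < m" for k
    unfolding S_def by (rule member_le_sum) (use that in auto)
  then have \<beta>: "norm (\<beta> k) \<le> 1" for k using S by (simp add: \<beta>_def norm_divide)
  have "norm (b / of_real S) \<le> 1" using b S unfolding S_def[symmetric] by (simp add: norm_divide)
  then have "norm (b / of_real S) * norm d + (\<Sum>k<m. norm (\<beta> k) * norm (v k)) - \<eta>
      \<le> norm (s (b / of_real S) d + (\<Sum>k<m. s (\<beta> k) (v k)))"
    using est \<beta> unfolding almost_l1_def by blast
  then have le: "S * (norm (b / of_real S) * norm d + (\<Sum>k<m. norm (\<beta> k) * norm (v k)) - \<eta>)
      \<le> S * norm (s (b / of_real S) d + (\<Sum>k<m. s (\<beta> k) (v k)))"
    using S by simp
  have "S * norm (s (b / of_real S) d + (\<Sum>k<m. s (\<beta> k) (v k)))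
      = norm (s (of_real S) (s (b / of_real S) d + (\<Sum>k<m. s (\<beta> k) (v k))))"
    using S by (simp add: norm_scale)
  also have "s (of_real S) (s (b / of_real S) d + (\<Sum>k<m. s (\<beta> k) (v k))) = s b d + (\<Sum>k<m. s (\<alpha> k) (v k))"
    using S by (simp add: scale_right_distrib scale_sum_right \<beta>_def)
  finally have R: "S * norm (s (b / of_real S) d + (\<Sum>k<m. s (\<beta> k) (v k))) = norm (s b d + (\<Sum>k<m. s (\<alpha> k) (v k)))" .
  have A: "S * (norm (b / of_real S) * norm d) = norm b * norm d" using S by (simp add: norm_divide)
  have B: "S * (\<Sum>k<m. norm (\<beta> k) * norm (v k)) = (\<Sum>k<m. norm (\<alpha> k) * norm (v k))"
    using S by (simp add: sum_distrib_left \<beta>_def norm_divide)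
  show ?thesis
    using le unfolding R right_diff_distrib distrib_left A B S_def[symmetric]
    by (simp add: mult.commute[of S])
qed

end

section \<open>The dual space and its weak* topology\<close>

lemma norm_dual_scl:
  fixes f :: "'a::real_normed_vector \<Rightarrow>\<^sub>L 'k::real_or_complex"
  shows "norm (dual_scl c f) = norm c * norm f"
proof -
  have le: "norm (dual_scl c f) \<le> norm c * norm f" for c and f :: "'a \<Rightarrow>\<^sub>L 'k"
    by (rule norm_blinfun_bound) (simp_all add: norm_mult mult.assoc mult_left_mono norm_blinfun)
  show ?thesis
  proof (cases "c = 0")
    case True
    then show ?thesis using le[of c f] by simp
  next
    case False
    then have "f = dual_scl (inverse c) (dual_scl c f)" by (intro blinfun_eqI) simp
    then have "norm f \<le> norm (inverse c) * norm (dual_scl c f)" using le by metis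
    then have "norm c * norm f \<le> norm (dual_scl c f)" using False unfolding norm_inverse by (simp add: field_simps)
    with le[of c f] show ?thesis by simp
  qed
qed

interpretation dual: normed_space_over
  "dual_scl :: 'k::real_or_complex \<Rightarrow> ('a::real_normed_vector \<Rightarrow>\<^sub>L 'k) \<Rightarrow> 'a \<Rightarrow>\<^sub>L 'k"
  by unfold_locales
    (auto intro!: blinfun_eqI simp: blinfun.add_right blinfun.add_left algebra_simps norm_dual_scl)

lemma subspace_dual_space: "dual.subspace (dual_space scl)"
  by (auto simp: dual.subspace_def dual_space_def blinfun.add_left algebra_simps)

lemmas dual_space_add = dual.subspace_add[OF subspace_dual_space]
  and dual_space_diff = dual.subspace_diff[OF subspace_dual_space]
  and dual_space_0 = dual.subspace_0[OF subspace_dual_space]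
  and dual_space_sum = dual.subspace_sum[OF subspace_dual_space]
  and dual_space_scale = dual.subspace_scale[OF subspace_dual_space]

lemma limitin_weak_star:
  "limitin (weak_star_topology scl) fs f sequentially \<longleftrightarrow>
     f \<in> dual_space scl \<and> (\<forall>\<^sub>F n in sequentially. fs n \<in> dual_space scl) \<and>
     (\<forall>x. (\<lambda>n. blinfun_apply (fs n) x) \<longlonglongrightarrow> blinfun_apply f x)"
proof -
  have "limitin (product_topology (\<lambda>_. euclidean) UNIV) (\<lambda>n. blinfun_apply (fs n)) (blinfun_apply f) sequentially
      \<longleftrightarrow> (\<forall>x. (\<lambda>n. blinfun_apply (fs n) x) \<longlonglongrightarrow> blinfun_apply f x)"
    unfolding limitin_componentwise by simp
  note coord = this[unfolded euclidean_product_topology]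
  have "limitin strong_operator_topology fs f sequentially \<longleftrightarrow>
      limitin euclidean (\<lambda>n. blinfun_apply (fs n)) (blinfun_apply f) sequentially"
    (is "?l \<longleftrightarrow> ?r")
  proof
    assume ?l
    then have "limitin euclidean (blinfun_apply \<circ> fs) (blinfun_apply f) sequentially"
      unfolding strong_operator_topology_def
      using continuous_map_limit[OF continuous_map_pullback[OF continuous_map_id]] by (simp only: id_comp)
    then show ?r by (simp add: o_def)
  next
    assume r: ?r
    show ?l
      unfolding limitin_def strong_operator_topology_topspace
    proof (intro conjI allI impI UNIV_I)
      fix U assume "openin strong_operator_topology U \<and> f \<in> U"
      then obtain V where V: "open V" "U = blinfun_apply -` V"
        and f: "blinfun_apply f \<in> V"
        unfolding strong_operator_topology_def openin_pullback_topology by auto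
      from r V f have "\<forall>\<^sub>F n in sequentially. blinfun_apply (fs n) \<in> V"
        unfolding limitin_def by auto
      then show "\<forall>\<^sub>F n in sequentially. fs n \<in> U" using V by simp
    qed
  qed
  also have "\<dots> \<longleftrightarrow> (\<forall>x. (\<lambda>n. blinfun_apply (fs n) x) \<longlonglongrightarrow> blinfun_apply f x)"
    unfolding coord ..
  finally show ?thesis unfolding weak_star_topology_def limitin_subtopology by blast
qed

lemma bounded_weak_star_subseq:
  fixes scl :: "'k::real_or_complex \<Rightarrow> 'a::real_normed_vector \<Rightarrow> 'a"
  assumes sc: "seq_compactin (weak_star_topology scl) (dual_ball scl)"
    and y: "\<And>n. y n \<in> dual_space scl" "\<And>n. norm (y n) \<le> M"
  obtains l r where "l \<in> dual_space scl" "strict_mono (r :: nat \<Rightarrow> nat)"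
    "\<And>x. (\<lambda>n. blinfun_apply (y (r n)) x) \<longlonglongrightarrow> blinfun_apply l x"
proof -
  define c where "c = \<bar>M\<bar> + 1"
  have c: "c > 0" "norm (y n) \<le> c" for n using y(2)[of n] by (simp_all add: c_def)
  define \<sigma> where "\<sigma> n = dual_scl (of_real (inverse c)) (y n)" for n
  have "norm (\<sigma> n) \<le> 1" for n
    using c(1) c(2)[of n] unfolding \<sigma>_def norm_dual_scl norm_of_real by (simp add: field_simps)
  moreover have "\<sigma> n \<in> dual_space scl" for n
    unfolding \<sigma>_def by (intro dual_space_scale y)
  ultimately have "range \<sigma> \<subseteq> dual_ball scl" by (auto simp: dual_ball_def)
  then obtain l r where l: "l \<in> dual_ball scl" "strict_mono r"
    "limitin (weak_star_topology scl) (\<sigma> \<circ> r) l sequentially"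
    using sc unfolding seq_compactin_def by blast
  show thesis
  proof (rule that)
    show "dual_scl (of_real c) l \<in> dual_space scl"
      using l(1) by (auto simp: dual_ball_def intro!: dual_space_scale)
    fix x
    have "(\<lambda>n. of_real c * blinfun_apply (\<sigma> (r n)) x) \<longlonglongrightarrow> of_real c * blinfun_apply l x"
      using l(3) unfolding limitin_weak_star by (intro tendsto_mult tendsto_const) auto
    moreover have "of_real c * blinfun_apply (\<sigma> (r n)) x = blinfun_apply (y (r n)) x" for n
      using c(1) by (simp add: \<sigma>_def)
    ultimately show "(\<lambda>n. blinfun_apply (y (r n)) x) \<longlonglongrightarrow> blinfun_apply (dual_scl (of_real c) l) x"
      by simp
  qed (rule l)
qed

text \<open>
  Property \<open>m\<^sub>1\<^sup>*\<close> holds if and only if the norm is asymptotically additive along bounded weak*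
  null sequences. For this direction, the property is applied to a subsequence on which additivity
  fails by a fixed amount.
\<close>

lemma m1_star_asymp_additive:
  fixes scl :: "'k::real_or_complex \<Rightarrow> 'a::real_normed_vector \<Rightarrow> 'a"
  assumes m1: "property_m1_star scl" and f: "f \<in> dual_space scl"
    and t: "\<And>n. t n \<in> dual_space scl" "\<And>n. norm (t n) \<le> M" "\<And>x. (\<lambda>n. blinfun_apply (t n) x) \<longlonglongrightarrow> 0"
    and e: "e > 0"
  shows "\<forall>\<^sub>F n in sequentially. norm f + norm (t n) - e \<le> norm (f + t n)"
proof (rule ccontr)
  assume "\<not> ?thesis"
  then obtain r :: "nat \<Rightarrow> nat" where r: "strict_mono r"
    and nle: "\<forall>n. \<not> norm f + norm (t (r n)) - e \<le> norm (f + t (r n))"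
    using not_eventually_sequentiallyD[of "\<lambda>n. norm f + norm (t n) - e \<le> norm (f + t n)"] by blast
  have le: "norm (t (r n) + f) \<le> norm f - e + norm (t (r n))" for n
    using nle[rule_format, of n] by (simp add: add.commute)
  define L where "L = limsup (\<lambda>n. ereal (norm (t (r n))))"
  have "0 \<le> L" unfolding L_def by (rule le_Limsup) simp_all
  moreover have "L \<le> ereal M" unfolding L_def
    by (rule Limsup_bounded) (simp add: t)
  ultimately obtain l where L: "L = ereal l" by (cases L) auto
  have "(\<lambda>n. blinfun_apply (t (r n)) x) \<longlonglongrightarrow> blinfun_apply 0 x" for x
    using LIMSEQ_subseq_LIMSEQ[OF t(3) r] by (simp add: o_def)
  then have "limitin (weak_star_topology scl) (\<lambda>n. t (r n)) 0 sequentially"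
    unfolding limitin_weak_star by (intro conjI allI dual_space_0 always_eventually t(1))
  moreover have "range (\<lambda>n. t (r n)) \<subseteq> dual_space scl" using t(1) by auto
  ultimately have "limsup (\<lambda>n. ereal (norm (t (r n) + f))) = ereal (norm f) + L"
    using m1 f unfolding property_m1_star_def L_def by blast
  moreover have "limsup (\<lambda>n. ereal (norm (t (r n) + f))) \<le> limsup (\<lambda>n. ereal (norm f - e) + ereal (norm (t (r n))))"
    using le by (intro Limsup_mono always_eventually allI) simp
  moreover have "\<dots> = ereal (norm f - e) + L" unfolding L_def by (rule Limsup_add_ereal_left) auto
  ultimately show False using e by (simp add: L)
qed

text \<open>
  Unbounded sequences need no additivity: if the upper limit of \<open>norm (fs n + f)\<close> is finite,
  then a tail of \<open>fs\<close> is bounded.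
\<close>

lemma asymp_additive_imp_m1_star:
  fixes scl :: "'k::real_or_complex \<Rightarrow> 'a::real_normed_vector \<Rightarrow> 'a"
  assumes add: "\<And>f t M e. f \<in> dual_space scl \<Longrightarrow> (\<And>n. t n \<in> dual_space scl) \<Longrightarrow> (\<And>n. norm (t n) \<le> M) \<Longrightarrow>
     (\<And>x. (\<lambda>n. blinfun_apply (t n) x) \<longlonglongrightarrow> 0) \<Longrightarrow> e > 0 \<Longrightarrow>
     \<forall>\<^sub>F n in sequentially. norm f + norm (t n) - e \<le> norm (f + t n)"
  shows "property_m1_star scl"
  unfolding property_m1_star_def
proof (intro ballI allI impI antisym)
  fix f fs assume f: "f \<in> dual_space scl" and fs: "range fs \<subseteq> dual_space scl"
    and lim: "limitin (weak_star_topology scl) fs 0 sequentially"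
  let ?S = "limsup (\<lambda>n. ereal (norm (fs n)))" and ?T = "limsup (\<lambda>n. ereal (norm (fs n + f)))"
  have "?T \<le> limsup (\<lambda>n. ereal (norm f) + ereal (norm (fs n)))"
    by (intro Limsup_mono always_eventually allI)
      (use norm_triangle_ineq[of f] in \<open>simp add: add.commute[of _ f]\<close>)
  also have "\<dots> = ereal (norm f) + ?S" by (rule Limsup_add_ereal_left) auto
  finally show "?T \<le> ereal (norm f) + ?S" .
  show "ereal (norm f) + ?S \<le> ?T"
  proof (cases "?T = \<infinity>")
    case False
    then obtain B where "?T < ereal B"
      by (meson ereal_dense2 ereal_infty_less(1))
    then have "\<forall>\<^sub>F n in sequentially. ereal (norm (fs n + f)) < ereal B" by (rule Limsup_lessD)
    then obtain N where N: "\<And>n. n \<ge> N \<Longrightarrow> norm (fs n + f) < B"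
      unfolding eventually_sequentially by auto
    define t where "t n = fs (n + N)" for n
    have t: "t n \<in> dual_space scl" for n using fs by (auto simp: t_def)
    have b: "norm (t n) \<le> B + norm f" for n
      using N[of "n + N"] norm_triangle_ineq4[of "fs (n + N) + f" f] by (simp add: t_def)
    have 0: "(\<lambda>n. blinfun_apply (t n) x) \<longlonglongrightarrow> 0" for x
      using lim unfolding limitin_weak_star t_def by (intro LIMSEQ_ignore_initial_segment) auto
    have S: "limsup (\<lambda>n. ereal (norm (t n))) = ?S"
      unfolding t_def by (rule limsup_shift_k)
    have T: "limsup (\<lambda>n. ereal (norm (f + t n))) = ?T"
      unfolding t_def using limsup_shift_k[of "\<lambda>n. ereal (norm (fs n + f))" N] by (simp add: add.commute)
    have le: "ereal (norm f - e) + ?S \<le> ?T" if "e > 0" for e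
    proof -
      have "ereal (norm f - e) + ?S = limsup (\<lambda>n. ereal (norm f - e) + ereal (norm (t n)))"
        unfolding S[symmetric] by (rule Limsup_add_ereal_left[symmetric]) auto
      also have "\<dots> \<le> ?T" unfolding T[symmetric]
        by (intro Limsup_mono eventually_mono[OF add[OF f t b 0 that]]) (simp add: algebra_simps)
      finally show ?thesis .
    qed
    show ?thesis
    proof (rule ereal_le_epsilon2)
      fix e :: real assume "0 < e"
      from le[OF this] show "ereal (norm f) + ?S \<le> ?T + ereal e"
        by (cases ?S; cases ?T) auto
    qed
  qed simp
qed

lemma almost_norming:
  assumes "banach_space_over scl" and f: "f \<in> dual_space scl" and "\<epsilon> > 0"
  shows "\<exists>x. norm x \<le> 1 \<and> norm f - \<epsilon> \<le> real_part (blinfun_apply f x)"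
proof (rule ccontr)
  interpret banach_space_over scl by fact
  assume "\<not> ?thesis"
  then have lt: "real_part (blinfun_apply f x) < norm f - \<epsilon>" if "norm x \<le> 1" for x
    using that not_le by blast
  have "norm f \<le> norm f - \<epsilon>"
  proof (rule norm_blinfun_bound)
    show "0 \<le> norm f - \<epsilon>" using lt[of 0] by (simp add: blinfun.zero_right)
    fix x
    show "norm (blinfun_apply f x) \<le> (norm f - \<epsilon>) * norm x"
    proof (cases "x = 0")
      case False
      obtain \<theta> where \<theta>: "norm \<theta> = 1" "blinfun_apply f x = of_real (norm (blinfun_apply f x)) * \<theta>" "\<theta> \<noteq> 0"
        by (rule sgn_scalar)
      define u where "u = (1 / norm x) *\<^sub>R scl (inverse \<theta>) x"
      have "norm u \<le> 1" using False \<theta>(1) by (simp add: u_def norm_scl norm_inverse)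
      moreover have "blinfun_apply f (scl (inverse \<theta>) x) = of_real (norm (blinfun_apply f x))"
        using f \<theta>(2,3) by (simp add: dual_space_def field_simps)
      then have "real_part (blinfun_apply f u) = norm (blinfun_apply f x) / norm x"
        by (simp add: u_def blinfun.scaleR_right real_part_scaleR)
      ultimately have "norm (blinfun_apply f x) / norm x \<le> norm f - \<epsilon>"
        using lt[of u] by simp
      then show ?thesis using False by (simp add: pos_divide_le_eq)
    qed (simp add: blinfun.zero_right)
  qed
  with \<open>\<epsilon> > 0\<close> show False by simp
qed

section \<open>The strong Schur property\<close>

lemma m1_star_almost_l1:
  fixes scl :: "'k::real_or_complex \<Rightarrow> 'a::real_normed_vector \<Rightarrow> 'a"
  assumes m1: "property_m1_star scl" and d: "d \<in> dual_space scl"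
    and t: "\<And>n. t n \<in> dual_space scl" "\<And>n. norm (t n) \<le> M" "\<And>x. (\<lambda>n. blinfun_apply (t n) x) \<longlonglongrightarrow> 0"
    and \<eta>: "\<eta> > 0"
  obtains r :: "nat \<Rightarrow> nat" where "strict_mono r"
    "dual.almost_l1 d (t \<circ> r) \<eta>"
proof (rule dual.almost_l1_subsequence[OF subspace_dual_space d t(1) \<eta>])
  show "\<forall>\<^sub>F n in sequentially. norm w + norm (t n) - e \<le> norm (w + t n)"
    if "w \<in> dual_space scl" "e > 0" for w e
    by (rule m1_star_asymp_additive[OF m1 that(1) t that(2)])
qed (rule that)

theorem m1_star_imp_one_strong_Schur:
  fixes scl :: "'k::real_or_complex \<Rightarrow> 'a::real_normed_vector \<Rightarrow> 'a"
  assumes m1: "property_m1_star scl"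
    and sc: "seq_compactin (weak_star_topology scl) (dual_ball scl)"
  shows "one_strong_Schur (dual_space scl) dual_scl"
  unfolding one_strong_Schur_def
proof (intro allI impI)
  fix \<delta> \<epsilon> :: real and y :: "nat \<Rightarrow> 'a \<Rightarrow>\<^sub>L 'k"
  assume \<delta>: "0 < \<delta>" "\<delta> \<le> 2" and \<epsilon>: "0 < \<epsilon>" and yD: "range y \<subseteq> dual_space scl"
    and y1: "\<forall>n. norm (y n) = 1" and sep: "\<forall>n m. n \<noteq> m \<longrightarrow> \<delta> \<le> norm (y n - y m)"
  have y: "y n \<in> dual_space scl" "norm (y n) \<le> 1" for n using yD y1 by auto
  obtain d r0 where d: "d \<in> dual_space scl" and r0: "strict_mono r0"
    and lim: "\<And>x. (\<lambda>n. blinfun_apply (y (r0 n)) x) \<longlonglongrightarrow> blinfun_apply d x"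
    by (rule bounded_weak_star_subseq[where y = y, OF sc y]) (rule that)
  have sep': "\<delta> \<le> norm (y (r0 n) - d) + norm (y (r0 m) - d)" if "n \<noteq> m" for n m
  proof -
    have "r0 n \<noteq> r0 m" using that r0 by (simp add: strict_mono_eq)
    then have "\<delta> \<le> norm ((y (r0 n) - d) - (y (r0 m) - d))" using sep by simp
    also have "\<dots> \<le> norm (y (r0 n) - d) + norm (y (r0 m) - d)" by (rule norm_triangle_ineq4)
    finally show ?thesis .
  qed
  \<comment> \<open>By separation, at most one term is closer than \<open>\<delta>/2\<close> to the limit.\<close>
  have "\<exists>N. \<forall>n\<ge>N. \<delta> / 2 \<le> norm (y (r0 n) - d)"
  proof (cases "\<exists>n. norm (y (r0 n) - d) < \<delta> / 2")
    case True
    then obtain n where n: "norm (y (r0 n) - d) < \<delta> / 2" by blast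
    have "\<delta> / 2 \<le> norm (y (r0 k) - d)" if "k \<ge> Suc n" for k
      using sep'[of n k] n that by linarith
    then show ?thesis by blast
  qed (auto simp: not_less)
  then obtain N where N: "\<And>n. n \<ge> N \<Longrightarrow> \<delta> / 2 \<le> norm (y (r0 n) - d)" by blast
  define t where "t n = y (r0 (n + N)) - d" for n
  have tD: "t n \<in> dual_space scl" for n unfolding t_def by (rule dual_space_diff[OF y(1) d])
  have tb: "norm (t n) \<le> 1 + norm d" for n
    using norm_triangle_ineq4[of "y (r0 (n + N))" d] y1[rule_format, of "r0 (n + N)"]
    unfolding t_def by linarith
  have t0: "(\<lambda>n. blinfun_apply (t n) x) \<longlonglongrightarrow> 0" for x
    unfolding t_def blinfun.diff_left
    by (rule LIM_zero, rule LIMSEQ_ignore_initial_segment, rule lim)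
  \<comment> \<open>The error that the required constant leaves below \<open>\<delta>/2\<close>.\<close>
  define \<eta> where "\<eta> = \<delta> / 2 - 1 / (2 / \<delta> + \<epsilon>)"
  have "2 / \<delta> > 0" using \<delta> by simp
  then have "1 / (2 / \<delta> + \<epsilon>) < 1 / (2 / \<delta>)"
    using \<epsilon> by (intro divide_strict_left_mono mult_pos_pos) linarith+
  then have \<eta>: "\<eta> > 0" by (simp add: \<eta>_def)
  obtain r where r: "strict_mono r" and l1: "dual.almost_l1 d (t \<circ> r) \<eta>"
    by (rule m1_star_almost_l1[where t = t, OF m1 d tD tb t0 \<eta>]) (rule that)
  define R where "R k = r0 (r k + N)" for k
  have R: "strict_mono R"
    using r r0 by (auto simp: R_def strict_mono_def)
  have "equivalent_to_l1_basis dual_scl (2 / \<delta> + \<epsilon>) (y \<circ> R)"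
    unfolding equivalent_to_l1_basis_def
  proof (intro conjI allI)
    show "norm ((y \<circ> R) j) = 1" for j using y1 by simp
    fix m and \<alpha> :: "nat \<Rightarrow> 'k"
    let ?S = "\<Sum>j<m. norm (\<alpha> j)"
    have "1 / (2 / \<delta> + \<epsilon>) * ?S = (\<Sum>k<m. norm (\<alpha> k) * (\<delta> / 2)) - \<eta> * ?S"
      unfolding sum_distrib_right[symmetric] \<eta>_def by (simp add: left_diff_distrib)
    also have "(\<Sum>k<m. norm (\<alpha> k) * (\<delta> / 2)) \<le> (\<Sum>k<m. norm (\<alpha> k) * norm (t (r k)))"
      unfolding t_def by (intro sum_mono mult_left_mono N) auto
    also have "(\<Sum>k<m. norm (\<alpha> k) * norm (t (r k))) - \<eta> * ?S
        \<le> norm (sum \<alpha> {..<m}) * norm d + (\<Sum>k<m. norm (\<alpha> k) * norm (t (r k))) - \<eta> * ?S"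
      by simp
    also have "\<dots> \<le> norm (dual_scl (sum \<alpha> {..<m}) d + (\<Sum>k<m. dual_scl (\<alpha> k) (t (r k))))"
      using dual.almost_l1_homogeneous[OF l1 norm_sum[of \<alpha> "{..<m}"]] by simp
    also have "dual_scl (sum \<alpha> {..<m}) d + (\<Sum>k<m. dual_scl (\<alpha> k) (t (r k)))
        = (\<Sum>j<m. dual_scl (\<alpha> j) ((y \<circ> R) j))"
      unfolding dual.scale_sum_left sum.distrib[symmetric] t_def R_def
      by (simp add: dual.scale_right_diff_distrib)
    finally show "1 / (2 / \<delta> + \<epsilon>) * ?S \<le> norm (\<Sum>j<m. dual_scl (\<alpha> j) ((y \<circ> R) j))" by simp
  qed
  with R show "\<exists>r. strict_mono r \<and> equivalent_to_l1_basis dual_scl (2 / \<delta> + \<epsilon>) (y \<circ> r)" by blast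
qed

section \<open>The Schur property\<close>

lemma ca_lower:
  assumes "bounded (range y)" and "\<And>n. \<exists>p\<ge>n. \<exists>q\<ge>n. c \<le> dist (y p) (y q)"
  shows "c \<le> ca y"
  unfolding ca_def
proof (rule cINF_greatest)
  fix n
  obtain p q where pq: "p \<ge> n" "q \<ge> n" "c \<le> dist (y p) (y q)" using assms(2) by blast
  have "bounded (y ` {n..})" using assms(1) by (rule bounded_subset) auto
  from diameter_bounded_bound[OF this, of "y p" "y q"] pq
  show "c \<le> diameter (y ` {n..})" by auto
qed simp

lemma ca_le_diameter:
  assumes "bounded (range y)"
  shows "ca y \<le> diameter (y ` {n..})"
  unfolding ca_def
proof (rule cINF_lower)
  have "bounded (y ` {n..})" for n using assms by (rule bounded_subset) auto
  then show "bdd_below (range (\<lambda>n. diameter (y ` {n..})))"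
    by (intro bdd_belowI2[of _ 0]) (simp add: diameter_ge_0)
qed simp

lemma ca_nonneg: "bounded (range y) \<Longrightarrow> 0 \<le> ca y"
  by (rule ca_lower) (auto intro!: exI)

lemma ca_far_pair:
  assumes "bounded (range y)" "0 < c" "c < ca y"
  shows "\<exists>p\<ge>n. \<exists>q\<ge>n. c < dist (y p) (y q)"
proof -
  have b: "bounded (y ` {n..})" using assms(1) by (rule bounded_subset) auto
  have "c < diameter (y ` {n..})" using assms(3) ca_le_diameter[OF assms(1), of n] by simp
  from diameter_lower_bounded[OF b assms(2) this] show ?thesis by auto
qed

lemma ca_functional_le_delta:
  assumes g: "g \<in> functional_ball Y scl" and y: "range y \<subseteq> Y" "bounded (range y)"
  shows "ca (\<lambda>n. g (y n)) \<le> delta Y scl y" and "bounded (range (\<lambda>n. g (y n)))"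
proof -
  obtain M where M: "\<And>n. norm (y n) \<le> M" using y(2) by (auto simp: bounded_iff)
  have le: "norm (h (y n)) \<le> M" if "h \<in> functional_ball Y scl" for h n
  proof -
    have "y n \<in> Y" using y(1) by auto
    then have "norm (h (y n)) \<le> norm (y n)" using that by (simp add: functional_ball_def)
    with M[of n] show ?thesis by simp
  qed
  have b: "bounded (range (\<lambda>n. h (y n)))" if "h \<in> functional_ball Y scl" for h
    using le[OF that] unfolding bounded_iff by auto
  show "bounded (range (\<lambda>n. g (y n)))" by (rule b[OF g])
  have "ca (\<lambda>n. h (y n)) \<le> 2 * M" if h: "h \<in> functional_ball Y scl" for h
  proof -
    have "diameter ((\<lambda>n. h (y n)) ` {0..}) \<le> 2 * M"
    proof (rule diameter_le)
      fix u v assume "u \<in> (\<lambda>n. h (y n)) ` {0..}" "v \<in> (\<lambda>n. h (y n)) ` {0..}"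
      then have "norm u \<le> M" "norm v \<le> M" using le[OF h] by auto
      then show "norm (u - v) \<le> 2 * M" using norm_triangle_ineq4[of u v] by simp
    qed simp
    then show ?thesis using ca_le_diameter[OF b[OF h], of 0] by simp
  qed
  then have "bdd_above ((\<lambda>h. ca (\<lambda>n. h (y n))) ` functional_ball Y scl)"
    by (intro bdd_aboveI2)
  then show "ca (\<lambda>n. g (y n)) \<le> delta Y scl y"
    unfolding delta_def by (rule cSUP_upper2[OF _ g]) simp
qed

lemma zero_in_functional_ball: "(\<lambda>_. 0) \<in> functional_ball Y scl"
  by (simp add: functional_ball_def)

text \<open>
  Evaluations at points of the unit ball cluster pointwise in the unit ball of the bidual
  (by Tychonoff's theorem), and closed conditions pass to the cluster point.
\<close>

lemma cluster_functional:
  fixes xs :: "nat \<Rightarrow> 'a::real_normed_vector" and scl :: "'k::real_or_complex \<Rightarrow> 'a \<Rightarrow> 'a"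
  assumes xs: "\<And>m. norm (xs m) \<le> 1"
  shows "\<exists>g \<in> functional_ball (dual_space scl) dual_scl. \<forall>f c.
     (\<forall>\<^sub>F m in sequentially. c \<le> real_part (blinfun_apply f (xs m))) \<longrightarrow> c \<le> real_part (g f)"
proof -
  define K where "K = PiE UNIV (\<lambda>f :: 'a \<Rightarrow>\<^sub>L 'k. cball (0::'k) (norm f))"
  define ev where "ev m f = blinfun_apply f (xs m)" for m and f :: "'a \<Rightarrow>\<^sub>L 'k"
  define F where "F = filtermap ev sequentially"
  have "compactin (product_topology (\<lambda>_. euclidean) UNIV) K"
    unfolding K_def by (subst compactin_PiE) (simp add: compact_cball_scalar)
  then have "compact K" by (simp add: euclidean_product_topology)
  have "norm (ev m f) \<le> norm f" for m f
    using order_trans[OF norm_blinfun mult_left_mono[OF xs[of m], of "norm f"]] by (simp add: ev_def)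
  then have "\<forall>\<^sub>F h in F. h \<in> K"
    unfolding F_def eventually_filtermap K_def by (simp add: PiE_UNIV_domain)
  moreover have "F \<noteq> bot" by (simp add: F_def filtermap_bot_iff)
  ultimately obtain g where g: "g \<in> K" "inf (nhds g) F \<noteq> bot"
    using \<open>compact K\<close> unfolding compact_filter by blast
  have cl: "g \<in> C" if "closed C" "\<forall>\<^sub>F m in sequentially. ev m \<in> C" for C
  proof (rule ccontr)
    assume "g \<notin> C"
    then have "\<forall>\<^sub>F h in nhds g. h \<in> - C"
      using that(1) by (intro eventually_nhds_in_open) auto
    moreover have "\<forall>\<^sub>F h in F. h \<in> C" using that(2) by (simp add: F_def eventually_filtermap)
    ultimately have "\<forall>\<^sub>F h in inf (nhds g) F. False"
      unfolding eventually_inf by blast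
    with g(2) show False by (simp add: trivial_limit_def)
  qed
  have cont: "continuous_on UNIV (\<lambda>h :: ('a \<Rightarrow>\<^sub>L 'k) \<Rightarrow> 'k. h f)" for f by simp
  have "g (x + y) = g x + g y" for x y
  proof -
    have "closed {h :: ('a \<Rightarrow>\<^sub>L 'k) \<Rightarrow> 'k. h (x + y) = h x + h y}"
      by (intro closed_Collect_eq continuous_on_add cont)
    from cl[OF this] show ?thesis by (simp add: ev_def blinfun.add_left)
  qed
  moreover have "g (dual_scl c y) = c * g y" for c y
  proof -
    have "closed {h :: ('a \<Rightarrow>\<^sub>L 'k) \<Rightarrow> 'k. h (dual_scl c y) = c * h y}"
      by (intro closed_Collect_eq continuous_on_mult continuous_on_const cont)
    from cl[OF this] show ?thesis by (simp add: ev_def)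
  qed
  moreover have "norm (g y) \<le> norm y" for y
    using g(1) by (auto simp: K_def PiE_UNIV_domain)
  ultimately have "g \<in> functional_ball (dual_space scl) dual_scl"
    by (simp add: functional_ball_def)
  moreover have "c \<le> real_part (g f)"
    if "\<forall>\<^sub>F m in sequentially. c \<le> real_part (blinfun_apply f (xs m))" for c f
  proof -
    have "closed {h :: ('a \<Rightarrow>\<^sub>L 'k) \<Rightarrow> 'k. c \<le> real_part (h f)}"
      by (intro closed_Collect_le continuous_on_const
          continuous_on_compose2[OF continuous_on_real_part[of UNIV] cont]) simp
    from cl[OF this] that show ?thesis by (simp add: ev_def)
  qed
  ultimately show ?thesis by blast
qed

text \<open>
  A single functional is almost norming for all \<open>d + v k\<close> at once. An almost norming point of
  \<open>d + v 0 + \<dots> + v (m - 1)\<close> must almost norm each summand, as the norm of the sum is nearly the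
  sum of the norms.
\<close>

lemma common_norming_functional:
  fixes scl :: "'k::real_or_complex \<Rightarrow> 'a::banach \<Rightarrow> 'a"
  assumes scl: "banach_space_over scl" and d: "d \<in> dual_space scl" and v: "\<And>k. v k \<in> dual_space scl"
    and l1: "dual.almost_l1 d v \<eta>" and \<eta>: "\<eta> > 0"
  shows "\<exists>g \<in> functional_ball (dual_space scl) dual_scl. \<forall>k. norm (d + v k) - 2 * \<eta> \<le> real_part (g (d + v k))"
proof -
  define f where "f m = d + (\<Sum>k<m. v k)" for m
  have fn: "norm d + (\<Sum>k<m. norm (v k)) - \<eta> \<le> norm (f m)" for m
    using l1[unfolded dual.almost_l1_def, rule_format, of 1 "\<lambda>_. 1" m] by (simp add: f_def)
  have "f m \<in> dual_space scl" for m
    unfolding f_def by (intro dual_space_add[OF d] dual_space_sum v)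
  from almost_norming[OF scl this \<eta>]
  obtain xs where xs: "\<And>m. norm (xs m) \<le> 1"
    and norming: "\<And>m. norm (f m) - \<eta> \<le> real_part (blinfun_apply (f m) (xs m))" by metis
  obtain g where g: "g \<in> functional_ball (dual_space scl) dual_scl"
    and lim: "\<And>f c. (\<forall>\<^sub>F m in sequentially. c \<le> real_part (blinfun_apply f (xs m))) \<Longrightarrow> c \<le> real_part (g f)"
    using cluster_functional[of xs scl, OF xs] by blast
  have "norm (d + v k) - 2 * \<eta> \<le> real_part (g (d + v k))" for k
  proof (rule lim, rule eventually_mono[OF eventually_gt_at_top[of k]])
    fix m assume k: "k < m"
    have le: "real_part (blinfun_apply h (xs m)) \<le> norm h" for h
      using order_trans[OF real_part_le order_trans[OF norm_blinfun mult_left_mono[OF xs[of m], of "norm h"]]]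
      by simp
    have "(\<Sum>j\<in>{..<m} - {k}. real_part (blinfun_apply (v j) (xs m))) \<le> (\<Sum>j\<in>{..<m} - {k}. norm (v j))"
      by (intro sum_mono le)
    moreover have "real_part (blinfun_apply (f m) (xs m)) = real_part (blinfun_apply (d + v k) (xs m))
        + (\<Sum>j\<in>{..<m} - {k}. real_part (blinfun_apply (v j) (xs m)))"
      using k by (simp add: f_def blinfun.add_left blinfun.sum_left real_part_add real_part_sum sum.remove[of "{..<m}" k])
    moreover have "(\<Sum>j<m. norm (v j)) = norm (v k) + (\<Sum>j\<in>{..<m} - {k}. norm (v j))"
      using k by (simp add: sum.remove)
    moreover have "norm (d + v k) \<le> norm d + norm (v k)" by (rule norm_triangle_ineq)
    ultimately show "norm (d + v k) - 2 * \<eta> \<le> real_part (blinfun_apply (d + v k) (xs m))"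
      using fn[of m] norming[of m] by linarith
  qed
  with g show ?thesis by blast
qed

theorem m1_star_imp_one_Schur:
  fixes scl :: "'k::real_or_complex \<Rightarrow> 'a::banach \<Rightarrow> 'a"
  assumes scl: "banach_space_over scl" and m1: "property_m1_star scl"
    and sc: "seq_compactin (weak_star_topology scl) (dual_ball scl)"
  shows "one_Schur (dual_space scl) dual_scl"
  unfolding one_Schur_def
proof (intro allI impI, rule ccontr)
  fix y :: "nat \<Rightarrow> 'a \<Rightarrow>\<^sub>L 'k"
  assume yD: "range y \<subseteq> dual_space scl" and yb: "bounded (range y)"
    and "\<not> ca y \<le> delta (dual_space scl) dual_scl y"
  let ?\<delta> = "delta (dual_space scl) dual_scl y"
  have \<delta>0: "0 \<le> ?\<delta>"
    using ca_functional_le_delta[OF zero_in_functional_ball yD yb] ca_nonneg order_trans by blast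
  define \<epsilon> where "\<epsilon> = ca y - ?\<delta>"
  have \<epsilon>: "\<epsilon> > 0" using \<open>\<not> ca y \<le> ?\<delta>\<close> by (simp add: \<epsilon>_def)
  define c where "c = ca y - \<epsilon> / 2"
  have c: "0 < c" "c < ca y" using \<epsilon> \<delta>0 by (simp_all add: c_def \<epsilon>_def field_simps)
  have "\<forall>n. \<exists>p q. n \<le> p \<and> n \<le> q \<and> c < dist (y p) (y q)" using ca_far_pair[OF yb c] by blast
  then obtain p q where p: "\<And>n. n \<le> p n" and q: "\<And>n. n \<le> q n"
    and far: "\<And>n. c < dist (y (p n)) (y (q n))" by metis
  obtain M where M: "\<And>n. norm (y n) \<le> M" using yb by (auto simp: bounded_iff)
  have yD': "y n \<in> dual_space scl" for n using yD by auto
  \<comment> \<open>It suffices that one functional is large on infinitely many of the far differences \<open>z\<close>.\<close>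
  define z where "z n = y (p n) - y (q n)" for n
  have zD: "z n \<in> dual_space scl" for n unfolding z_def by (rule dual_space_diff[OF yD' yD'])
  have zb: "norm (z n) \<le> 2 * M" for n
    using norm_triangle_ineq4[of "y (p n)" "y (q n)"] M[of "p n"] M[of "q n"] by (simp add: z_def)
  obtain d r0 where d: "d \<in> dual_space scl" and r0: "strict_mono r0"
    and lim: "\<And>x. (\<lambda>n. blinfun_apply (z (r0 n)) x) \<longlonglongrightarrow> blinfun_apply d x"
    by (rule bounded_weak_star_subseq[where y = z, OF sc zD zb]) (rule that)
  define t where "t n = z (r0 n) - d" for n
  have tD: "t n \<in> dual_space scl" for n unfolding t_def by (rule dual_space_diff[OF zD d])
  have tb: "norm (t n) \<le> 2 * M + norm d" for n
    using norm_triangle_ineq4[of "z (r0 n)" d] zb[of "r0 n"] by (simp add: t_def)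
  have t0: "(\<lambda>n. blinfun_apply (t n) x) \<longlonglongrightarrow> 0" for x
    unfolding t_def blinfun.diff_left by (rule LIM_zero, rule lim)
  have \<eta>: "\<epsilon> / 8 > 0" using \<epsilon> by simp
  obtain r where r: "strict_mono r" and l1: "dual.almost_l1 d (t \<circ> r) (\<epsilon> / 8)"
    by (rule m1_star_almost_l1[where t = t, OF m1 d tD tb t0 \<eta>]) (rule that)
  have "(t \<circ> r) k \<in> dual_space scl" for k using tD by simp
  from common_norming_functional[OF scl d this l1 \<eta>]
  obtain g where g: "g \<in> functional_ball (dual_space scl) dual_scl"
    and gn: "\<And>k. norm (d + t (r k)) - 2 * (\<epsilon> / 8) \<le> real_part (g (d + t (r k)))" by auto
  have "c - \<epsilon> / 4 \<le> ca (\<lambda>n. g (y n))"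
  proof (rule ca_lower[OF ca_functional_le_delta(2)[OF g yD yb]])
    fix n
    let ?j = "r0 (r n)"
    have "n \<le> ?j" using r0 r by (meson order_trans strict_mono_imp_increasing)
    then have pq: "n \<le> p ?j" "n \<le> q ?j" using p q order_trans by blast+
    have zt: "d + t (r n) = z ?j" by (simp add: t_def)
    have "g (y (p ?j)) = g (z ?j + y (q ?j))" by (simp add: z_def)
    also have "\<dots> = g (z ?j) + g (y (q ?j))" using g zD yD' by (simp add: functional_ball_def)
    finally have "real_part (g (z ?j)) \<le> dist (g (y (p ?j))) (g (y (q ?j)))"
      by (simp add: dist_norm real_part_le)
    moreover have "c < norm (z ?j)" using far by (simp add: z_def dist_norm)
    ultimately have "c - \<epsilon> / 4 \<le> dist (g (y (p ?j))) (g (y (q ?j)))"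
      using gn[of n] unfolding zt by simp
    with pq show "\<exists>p\<ge>n. \<exists>q\<ge>n. c - \<epsilon> / 4 \<le> dist (g (y p)) (g (y q))" by blast
  qed
  also have "\<dots> \<le> ?\<delta>" by (rule ca_functional_le_delta(1)[OF g yD yb])
  finally show False using \<epsilon> by (simp add: c_def \<epsilon>_def field_simps)
qed

section \<open>The Hahn-Banach theorem\<close>

text \<open>
  Subadditive and positively homogeneous; the inequality in the second condition implies equality,
  see \<open>sublinear_scale\<close>.
\<close>

definition sublinear :: "('v::real_vector \<Rightarrow> real) \<Rightarrow> bool" where
  "sublinear q \<longleftrightarrow> (\<forall>x y. q (x + y) \<le> q x + q y) \<and> (\<forall>r>0. \<forall>x. q (r *\<^sub>R x) \<le> r * q x)"

lemma sublinear_add: "sublinear q \<Longrightarrow> q (x + y) \<le> q x + q y"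
  and sublinear_scale_le: "sublinear q \<Longrightarrow> r > 0 \<Longrightarrow> q (r *\<^sub>R x) \<le> r * q x"
  by (simp_all add: sublinear_def)

lemma sublinear_scale:
  assumes "sublinear q" "r > 0"
  shows "q (r *\<^sub>R x) = r * q x"
proof (rule antisym[OF sublinear_scale_le[OF assms]])
  have "q x \<le> inverse r * q (r *\<^sub>R x)"
    using sublinear_scale_le[OF assms(1), of "inverse r" "r *\<^sub>R x"] assms(2) by simp
  then show "r * q x \<le> q (r *\<^sub>R x)" using assms(2) by (simp add: field_simps)
qed

lemma sublinear_zero: "sublinear q \<Longrightarrow> q 0 = 0"
  using sublinear_scale[of q 2 0] by simp

lemma sublinear_minus: "sublinear q \<Longrightarrow> - q (- x) \<le> q x"
  using sublinear_add[of q x "- x"] sublinear_zero[of q] by simp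

text \<open>
  A sublinear functional can be lowered along a direction \<open>a\<close> while staying sublinear; minimality says that
  nothing is gained, which gives superadditivity.
\<close>

lemma minimal_sublinear_linear:
  assumes q: "sublinear q" and min: "\<And>q'. sublinear q' \<Longrightarrow> q' \<le> q \<Longrightarrow> q' = q"
  shows "linear q"
proof -
  have bound: "- q (- x) \<le> q (x + t *\<^sub>R a) - t * q a" if "t \<ge> 0" for x a t
  proof -
    have "q (t *\<^sub>R a) = t * q a" using that sublinear_scale[OF q] sublinear_zero[OF q] by (cases "t = 0") auto
    with sublinear_add[OF q, of "x + t *\<^sub>R a" "- x"] show ?thesis by simp
  qed
  have le: "q x + q a \<le> q (x + a)" for x a
  proof -
    \<comment> \<open>The largest sublinear functional below \<open>q\<close> taking at \<open>- a\<close> at most the value \<open>- q a\<close>.\<close>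
    define q' where "q' x = (INF t\<in>{0..}. q (x + t *\<^sub>R a) - t * q a)" for x
    have lower: "q' x \<le> q (x + t *\<^sub>R a) - t * q a" if "t \<ge> 0" for x t
      unfolding q'_def by (rule cINF_lower) (use bound that in \<open>auto intro!: bdd_belowI2\<close>)
    have greatest: "b \<le> q' x" if "\<And>t. t \<ge> 0 \<Longrightarrow> b \<le> q (x + t *\<^sub>R a) - t * q a" for b x
      unfolding q'_def by (rule cINF_greatest) (use that in auto)
    have "sublinear q'"
      unfolding sublinear_def
    proof (intro conjI allI impI)
      fix x y
      have "q' (x + y) - (q (y + t *\<^sub>R a) - t * q a) \<le> q (x + s *\<^sub>R a) - s * q a" if "s \<ge> 0" "t \<ge> 0" for s t
        using lower[of "s + t" "x + y"] sublinear_add[OF q, of "x + s *\<^sub>R a" "y + t *\<^sub>R a"] that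
        by (simp add: algebra_simps)
      then have "q' (x + y) - (q (y + t *\<^sub>R a) - t * q a) \<le> q' x" if "t \<ge> 0" for t
        using that by (intro greatest)
      then have "q' (x + y) - q' x \<le> q (y + t *\<^sub>R a) - t * q a" if "t \<ge> 0" for t
        using that by (simp add: algebra_simps)
      then have "q' (x + y) - q' x \<le> q' y" by (rule greatest)
      then show "q' (x + y) \<le> q' x + q' y" by simp
    next
      fix r :: real and x assume r: "0 < r"
      have "inverse r * q' (r *\<^sub>R x) \<le> q (x + t *\<^sub>R a) - t * q a" if "t \<ge> 0" for t
      proof -
        have "q' (r *\<^sub>R x) \<le> q (r *\<^sub>R (x + t *\<^sub>R a)) - (r * t) * q a"
          using lower[of "r * t" "r *\<^sub>R x"] r that by (simp add: scaleR_right_distrib)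
        also have "\<dots> = r * (q (x + t *\<^sub>R a) - t * q a)"
          unfolding sublinear_scale[OF q r] by (simp add: algebra_simps)
        finally show ?thesis using r by (simp add: field_simps)
      qed
      then have "inverse r * q' (r *\<^sub>R x) \<le> q' x" by (rule greatest)
      then show "q' (r *\<^sub>R x) \<le> r * q' x" using r by (simp add: field_simps)
    qed
    moreover have "q' \<le> q" unfolding le_fun_def using lower[of 0] by simp
    ultimately have "q' = q" by (rule min)
    then show ?thesis using lower[of 1 x] by simp
  qed
  have add: "q (x + y) = q x + q y" for x y
    using sublinear_add[OF q] le by (rule antisym)
  have neg: "q (- x) = - q x" for x
    using add[of x "- x"] sublinear_zero[OF q] by simp
  show ?thesis
  proof (rule linearI)
    show "q (r *\<^sub>R x) = r *\<^sub>R q x" for r x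
    proof (cases r "0::real" rule: linorder_cases)
      case less
      then have "q (- ((- r) *\<^sub>R x)) = - ((- r) * q x)" unfolding neg using sublinear_scale[OF q, of "- r" x] by simp
      then show ?thesis by simp
    qed (use sublinear_zero[OF q] sublinear_scale[OF q] in auto)
  qed (rule add)
qed

lemma sublinear_dominates_linear:
  fixes p :: "'v::real_vector \<Rightarrow> real"
  assumes p: "sublinear p"
  shows "\<exists>L. linear L \<and> (\<forall>x. L x \<le> p x)"
proof -
  define A where "A = {q. sublinear q \<and> q \<le> p}"
  have "\<exists>m\<in>A. \<forall>a\<in>A. a \<le> m \<longrightarrow> a = m"
  proof (rule predicate_Zorn[where P = "\<lambda>a b. b \<le> a"])
    show "partial_order_on A (relation_of (\<lambda>a b. b \<le> a) A)"
      by (rule partial_order_on_relation_ofI) auto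
    fix C assume C: "C \<in> Chains (relation_of (\<lambda>a b. b \<le> a) A)"
    then have CA: "C \<subseteq> A" and comp: "\<And>a b. a \<in> C \<Longrightarrow> b \<in> C \<Longrightarrow> a \<le> b \<or> b \<le> a"
      unfolding Chains_def relation_of_def by auto
    show "\<exists>u\<in>A. \<forall>a\<in>C. u \<le> a"
    proof (cases "C = {}")
      case True
      then show ?thesis using p by (auto simp: A_def)
    next
      case False
      define u where "u x = (INF q\<in>C. q x)" for x
      have "- p (- x) \<le> q x" if "q \<in> C" for q x
      proof -
        have "sublinear q" "q (- x) \<le> p (- x)" using that CA by (auto simp: A_def le_fun_def)
        then show ?thesis using sublinear_minus[of q x] by simp
      qed
      then have lower: "u x \<le> q x" if "q \<in> C" for q x
        unfolding u_def using that by (intro cINF_lower bdd_belowI2)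
      have greatest: "b \<le> u x" if "\<And>q. q \<in> C \<Longrightarrow> b \<le> q x" for b x
        unfolding u_def using False that by (intro cINF_greatest)
      have sub: "sublinear q" if "q \<in> C" for q using that CA by (auto simp: A_def)
      have "sublinear u"
        unfolding sublinear_def
      proof (intro conjI allI impI)
        fix x y
        have both: "u (x + y) \<le> q x + q' y" if qq: "q \<in> C" "q' \<in> C" for q q'
        proof -
          \<comment> \<open>Two members of a chain are comparable, and the smaller one serves both summands.\<close>
          obtain h where h: "h \<in> C" "h \<le> q" "h \<le> q'" using comp[OF qq] qq by blast
          then have "h x \<le> q x" "h y \<le> q' y" by (simp_all add: le_fun_def)
          then show ?thesis
            using lower[OF h(1), of "x + y"] sublinear_add[OF sub[OF h(1)], of x y] by linarith
        qed
        have "u (x + y) - q' y \<le> u x" if "q' \<in> C" for q'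
          using both[OF _ that] by (intro greatest) (simp add: algebra_simps)
        then have "u (x + y) - u x \<le> q' y" if "q' \<in> C" for q'
          using that by (simp add: algebra_simps)
        then have "u (x + y) - u x \<le> u y" by (rule greatest)
        then show "u (x + y) \<le> u x + u y" by simp
      next
        fix r :: real and x assume r: "0 < r"
        have "inverse r * u (r *\<^sub>R x) \<le> q x" if "q \<in> C" for q
          using lower[OF that, of "r *\<^sub>R x"] sublinear_scale[OF sub[OF that] r] r by (simp add: field_simps)
        then have "inverse r * u (r *\<^sub>R x) \<le> u x" by (rule greatest)
        then show "u (r *\<^sub>R x) \<le> r * u x" using r by (simp add: field_simps)
      qed
      moreover have "u \<le> p"
      proof -
        obtain q where "q \<in> C" using False by blast
        then have "u \<le> q" "q \<le> p" using lower CA by (auto simp: le_fun_def A_def)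
        then show ?thesis by simp
      qed
      ultimately have "u \<in> A" by (simp add: A_def)
      moreover have "\<forall>a\<in>C. u \<le> a" using lower by (simp add: le_fun_def)
      ultimately show ?thesis by blast
    qed
  qed
  then obtain m where m: "sublinear m" "m \<le> p" and min: "\<And>a. sublinear a \<Longrightarrow> a \<le> p \<Longrightarrow> a \<le> m \<Longrightarrow> a = m"
    unfolding A_def by blast
  have "linear m" by (rule minimal_sublinear_linear[OF m(1)]) (use m(2) min in \<open>auto intro: order_trans\<close>)
  with m(2) show ?thesis by (auto simp: le_fun_def)
qed

text \<open>
  Norm preserving extension along a linear map \<open>T\<close>. The map \<open>T\<close> plays the role of the inclusion of a
  subspace.
\<close>

lemma hahn_banach_along:
  fixes T :: "'x::real_vector \<Rightarrow> 'v::real_normed_vector"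
  assumes T: "linear T" and l: "linear l" and M: "0 \<le> M" and le: "\<And>x. l x \<le> M * norm (T x)"
  shows "\<exists>L. linear L \<and> (\<forall>x. L (T x) = l x) \<and> (\<forall>v. L v \<le> M * norm v)"
proof -
  \<comment> \<open>A sublinear functional below the multiple of the norm, and below \<open>l\<close> on the range of \<open>T\<close>.\<close>
  define p where "p v = (INF x. M * norm (v - T x) + l x)" for v
  have "- (M * norm v) \<le> M * norm (v - T x) + l x" for v x
  proof -
    have "- l x \<le> M * norm (T x)" using le[of "- x"] by (simp add: linear_neg[OF l] linear_neg[OF T])
    also have "\<dots> \<le> M * (norm v + norm (v - T x))"
      using norm_triangle_ineq4[of v "v - T x"] by (intro mult_left_mono[OF _ M]) simp
    finally show ?thesis by (simp add: algebra_simps)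
  qed
  then have lower: "p v \<le> M * norm (v - T x) + l x" for v x
    unfolding p_def by (intro cINF_lower bdd_belowI2) auto
  have greatest: "b \<le> p v" if "\<And>x. b \<le> M * norm (v - T x) + l x" for b v
    unfolding p_def using that by (intro cINF_greatest) auto
  have "sublinear p"
    unfolding sublinear_def
  proof (intro conjI allI impI)
    fix v w
    have both: "p (v + w) \<le> (M * norm (v - T x) + l x) + (M * norm (w - T y) + l y)" for x y
    proof -
      have "M * norm (v + w - T (x + y)) \<le> M * (norm (v - T x) + norm (w - T y))"
        using norm_triangle_ineq[of "v - T x" "w - T y"]
        by (intro mult_left_mono[OF _ M]) (simp add: linear_add[OF T] algebra_simps)
      then show ?thesis using lower[of "v + w" "x + y"] by (simp add: linear_add[OF l] algebra_simps)
    qed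
    have "p (v + w) - (M * norm (w - T y) + l y) \<le> p v" for y
      by (rule greatest) (use both in \<open>simp add: algebra_simps\<close>)
    then have "p (v + w) - p v \<le> p w" by (intro greatest) (simp add: algebra_simps)
    then show "p (v + w) \<le> p v + p w" by simp
  next
    fix r :: real and v assume r: "0 < r"
    have "inverse r * p (r *\<^sub>R v) \<le> M * norm (v - T x) + l x" for x
    proof -
      have "norm (r *\<^sub>R v - T (r *\<^sub>R x)) = r * norm (v - T x)"
        using r by (simp add: linear_scale[OF T] scaleR_right_diff_distrib[symmetric])
      then have "p (r *\<^sub>R v) \<le> r * (M * norm (v - T x) + l x)"
        using lower[of "r *\<^sub>R v" "r *\<^sub>R x"] by (simp add: linear_scale[OF l] algebra_simps)
      then show ?thesis using r by (simp add: field_simps)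
    qed
    then have "inverse r * p (r *\<^sub>R v) \<le> p v" by (rule greatest)
    then show "p (r *\<^sub>R v) \<le> r * p v" using r by (simp add: field_simps)
  qed
  then obtain L where L: "linear L" "\<And>v. L v \<le> p v" using sublinear_dominates_linear by blast
  have upper: "L (T x) \<le> l x" for x
    using L(2)[of "T x"] lower[of "T x" x] by simp
  have "L (T x) = l x" for x
    using upper[of x] upper[of "- x"] by (simp add: linear_neg[OF T] linear_neg[OF l] linear_neg[OF L(1)])
  moreover have "L v \<le> M * norm v" for v
    using L(2)[of v] lower[of v 0] by (simp add: linear_0[OF T] linear_0[OF l])
  ultimately show ?thesis using L(1) by blast
qed

section \<open>Functionals on subspaces of the space of null families\<close>

text \<open>
  An isometric embedding \<open>T\<close> into the null families over the whole index type; families over a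
  subset are extended by 0.
\<close>

locale c0_embedding = banach_space_over scl
  for scl :: "'k::real_or_complex \<Rightarrow> 'a::banach \<Rightarrow> 'a" +
  fixes T :: "'a \<Rightarrow> 'g \<Rightarrow> 'k"
  assumes T_add: "T (x + y) \<gamma> = T x \<gamma> + T y \<gamma>"
    and T_scl: "T (scl c x) \<gamma> = c * T x \<gamma>"
    and T_null: "e > 0 \<Longrightarrow> finite {\<gamma>. e \<le> norm (T x \<gamma>)}"
    and T_le: "norm (T x \<gamma>) \<le> norm x"
    and T_least: "0 \<le> b \<Longrightarrow> (\<And>\<gamma>. norm (T x \<gamma>) \<le> b) \<Longrightarrow> norm x \<le> b"
begin

lemma T_scaleR: "T (r *\<^sub>R x) \<gamma> = r *\<^sub>R T x \<gamma>"
  using T_scl[of "of_real r" x \<gamma>] by (simp add: scl_of_real scaleR_conv_of_real)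

text \<open>
  The family \<open>a\<close> represents \<open>f\<close> with constant \<open>M\<close>: it is absolutely summable with sum at most \<open>M\<close>,
  and \<open>f x\<close> is the sum of \<open>a \<gamma> * T x \<gamma>\<close>. Convergence of the latter is expressed by an error
  estimate for finite partial sums.
\<close>

definition represents :: "('g \<Rightarrow> 'k) \<Rightarrow> real \<Rightarrow> ('a \<Rightarrow> 'k) \<Rightarrow> bool" where
  "represents a M f \<longleftrightarrow> (\<forall>F. finite F \<longrightarrow> (\<Sum>\<gamma>\<in>F. norm (a \<gamma>)) \<le> M) \<and>
     (\<forall>x F e. finite F \<longrightarrow> 0 \<le> e \<longrightarrow> (\<forall>\<gamma>. \<gamma> \<notin> F \<longrightarrow> norm (T x \<gamma>) \<le> e) \<longrightarrow>
        norm (f x - (\<Sum>\<gamma>\<in>F. a \<gamma> * T x \<gamma>)) \<le> M * e)"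

lemma represents_sum_le: "represents a M f \<Longrightarrow> finite F \<Longrightarrow> (\<Sum>\<gamma>\<in>F. norm (a \<gamma>)) \<le> M"
  by (simp add: represents_def)

lemma represents_error:
  "represents a M f \<Longrightarrow> finite F \<Longrightarrow> 0 \<le> e \<Longrightarrow> (\<And>\<gamma>. \<gamma> \<notin> F \<Longrightarrow> norm (T x \<gamma>) \<le> e) \<Longrightarrow>
     norm (f x - (\<Sum>\<gamma>\<in>F. a \<gamma> * T x \<gamma>)) \<le> M * e"
  by (simp add: represents_def)

lemma represents_norm_le: "represents a M f \<Longrightarrow> norm (f x) \<le> M * norm x"
  using represents_error[of a M f "{}" "norm x" x] T_le by simp

lemma represents_mono:
  assumes "represents a M f" "M \<le> B" shows "represents a B f"
  unfolding represents_def
proof (intro conjI allI impI)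
  show "(\<Sum>\<gamma>\<in>F. norm (a \<gamma>)) \<le> B" if "finite F" for F
    using represents_sum_le[OF assms(1) that] assms(2) by simp
  show "norm (f x - (\<Sum>\<gamma>\<in>F. a \<gamma> * T x \<gamma>)) \<le> B * e"
    if "finite F" "0 \<le> e" "\<forall>\<gamma>. \<gamma> \<notin> F \<longrightarrow> norm (T x \<gamma>) \<le> e" for x F e
    using represents_error[OF assms(1) that(1,2), of x] that(3) mult_right_mono[OF assms(2) that(2)]
    by simp
qed

text \<open>
  Every functional is represented with its norm as the constant. The Hahn-Banach theorem is
  applied inside the bounded families, realized as the bounded continuous functions on the
  discrete index set; the coefficients are the values at the unit vectors.
\<close>

lemma representation:
  assumes f: "f \<in> dual_space scl"
  shows "\<exists>a. represents a (norm f) (blinfun_apply f)"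
proof -
  define J :: "('g \<Rightarrow> 'k) \<Rightarrow> ('g discrete \<Rightarrow>\<^sub>C 'k)" where "J u = Bcontfun (\<lambda>g. u (of_discrete g))" for u
  have J: "apply_bcontfun (J u) g = u (of_discrete g)" if "\<And>\<gamma>. norm (u \<gamma>) \<le> b" for u b g
  proof -
    have "continuous_on UNIV (\<lambda>g. u (of_discrete g))"
      unfolding continuous_on_open_invariant using open_discrete by auto
    then have "(\<lambda>g. u (of_discrete g)) \<in> bcontfun" by (rule bcontfun_normI) (rule that)
    then show ?thesis unfolding J_def by (simp add: Bcontfun_inverse)
  qed
  have JT: "apply_bcontfun (J (T x)) g = T x (of_discrete g)" for x g by (rule J) (rule T_le)
  have linJ: "linear (\<lambda>x. J (T x))"
    by (rule linearI; rule bcontfun_eqI; simp add: JT T_add T_scaleR)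
  have linf: "linear (\<lambda>x. real_part (blinfun_apply f x))"
    by (rule linearI) (simp_all add: blinfun.add_right real_part_add blinfun.scaleR_right real_part_scaleR)
  have le: "real_part (blinfun_apply f x) \<le> norm f * norm (J (T x))" for x
  proof -
    have "norm x \<le> norm (J (T x))"
      using norm_bounded[of "J (T x)" "discrete _"] by (intro T_least) (simp_all add: JT discrete_inverse)
    then have "norm f * norm x \<le> norm f * norm (J (T x))" by (rule mult_left_mono) simp
    then show ?thesis using real_part_le[of "blinfun_apply f x"] norm_blinfun[of f x] by linarith
  qed
  obtain L where linL: "linear L" and Lf: "\<And>x. L (J (T x)) = real_part (blinfun_apply f x)"
    and Lle: "\<And>v. L v \<le> norm f * norm v"
    using hahn_banach_along[OF linJ linf norm_ge_zero le] by blast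
  define E where "E F c = J (\<lambda>\<gamma>. if \<gamma> \<in> F then c \<gamma> else 0)" for F and c :: "'g \<Rightarrow> 'k"
  have E: "apply_bcontfun (E F c) g = (if of_discrete g \<in> F then c (of_discrete g) else 0)"
    if F: "finite F" for F c g
    unfolding E_def
  proof (rule J)
    show "norm (if \<gamma> \<in> F then c \<gamma> else 0) \<le> (\<Sum>\<gamma>\<in>F. norm (c \<gamma>))" for \<gamma>
      using member_le_sum[of \<gamma> F "\<lambda>\<gamma>. norm (c \<gamma>)"] F by (simp add: sum_nonneg)
  qed
  have "\<exists>a. \<forall>z. L (E {\<gamma>} (\<lambda>_. z)) = real_part (a * z)" for \<gamma>
  proof (rule real_part_riesz)
    have "linear (\<lambda>z. E {\<gamma>} (\<lambda>_. z))"
      by (rule linearI; rule bcontfun_eqI; simp add: E)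
    from linear_compose[OF this linL] show "linear (\<lambda>z. L (E {\<gamma>} (\<lambda>_. z)))" by (simp add: o_def)
  qed
  then obtain a where a: "\<And>\<gamma> z. L (E {\<gamma>} (\<lambda>_. z)) = real_part (a \<gamma> * z)" by metis
  have LE: "L (E F c) = (\<Sum>\<gamma>\<in>F. real_part (a \<gamma> * c \<gamma>))" if "finite F" for F c
    using that
  proof induction
    case empty
    have "E {} c = 0" by (rule bcontfun_eqI) (simp add: E)
    then show ?case by (simp add: linear_0[OF linL])
  next
    case (insert \<gamma> F)
    have "E (insert \<gamma> F) c = E {\<gamma>} (\<lambda>_. c \<gamma>) + E F c"
      by (rule bcontfun_eqI) (use insert in \<open>auto simp: E\<close>)
    then show ?case using insert by (simp add: linear_add[OF linL] a)
  qed
  have "represents a (norm f) (blinfun_apply f)"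
    unfolding represents_def
  proof (intro conjI allI impI)
    fix F :: "'g set" assume F: "finite F"
    have "\<exists>\<theta>. norm \<theta> = 1 \<and> a \<gamma> * \<theta> = of_real (norm (a \<gamma>))" for \<gamma>
    proof -
      obtain \<theta> where \<theta>: "norm \<theta> = 1" "a \<gamma> = of_real (norm (a \<gamma>)) * \<theta>" "\<theta> \<noteq> 0"
        by (rule sgn_scalar)
      then have "a \<gamma> * inverse \<theta> = of_real (norm (a \<gamma>))" by (simp add: field_simps)
      then show ?thesis using \<theta>(1) by (intro exI[of _ "inverse \<theta>"]) (simp add: norm_inverse)
    qed
    then obtain c where c: "\<And>\<gamma>. norm (c \<gamma>) = 1" "\<And>\<gamma>. a \<gamma> * c \<gamma> = of_real (norm (a \<gamma>))" by metis
    have "(\<Sum>\<gamma>\<in>F. norm (a \<gamma>)) = L (E F c)" by (simp add: LE[OF F] c)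
    also have "\<dots> \<le> norm f * norm (E F c)" by (rule Lle)
    also have "\<dots> \<le> norm f * 1" by (intro mult_left_mono norm_bound) (simp_all add: E[OF F] c)
    finally show "(\<Sum>\<gamma>\<in>F. norm (a \<gamma>)) \<le> norm f" by simp
  next
    fix x F and e :: real
    assume F: "finite F" and e: "0 \<le> e" and off: "\<forall>\<gamma>. \<gamma> \<notin> F \<longrightarrow> norm (T x \<gamma>) \<le> e"
    have re: "real_part (blinfun_apply f x - (\<Sum>\<gamma>\<in>F. a \<gamma> * T x \<gamma>)) \<le> norm f * e"
      if "\<And>\<gamma>. \<gamma> \<notin> F \<Longrightarrow> norm (T x \<gamma>) \<le> e" for x
    proof -
      have "real_part (blinfun_apply f x - (\<Sum>\<gamma>\<in>F. a \<gamma> * T x \<gamma>)) = L (J (T x) - E F (T x))"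
        by (simp add: real_part_diff real_part_sum linear_diff[OF linL] Lf LE[OF F])
      also have "\<dots> \<le> norm f * norm (J (T x) - E F (T x))" by (rule Lle)
      also have "\<dots> \<le> norm f * e"
        by (intro mult_left_mono norm_bound) (use that e in \<open>auto simp: JT E[OF F]\<close>)
      finally show ?thesis .
    qed
    \<comment> \<open>Rotating \<open>x\<close> turns the estimate of the real part into one of the norm.\<close>
    define w where "w = blinfun_apply f x - (\<Sum>\<gamma>\<in>F. a \<gamma> * T x \<gamma>)"
    obtain \<theta> where \<theta>: "norm \<theta> = 1" "w = of_real (norm w) * \<theta>" "\<theta> \<noteq> 0" by (rule sgn_scalar)
    have "norm (T (scl (inverse \<theta>) x) \<gamma>) \<le> e" if "\<gamma> \<notin> F" for \<gamma>
      using off that \<theta>(1) by (simp add: T_scl norm_mult norm_inverse)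
    note re[OF this]
    moreover have "blinfun_apply f (scl (inverse \<theta>) x) - (\<Sum>\<gamma>\<in>F. a \<gamma> * T (scl (inverse \<theta>) x) \<gamma>) = inverse \<theta> * w"
      using f by (simp add: dual_space_def T_scl w_def right_diff_distrib sum_distrib_left mult.left_commute)
    moreover have "inverse \<theta> * w = of_real (norm w)"
      using \<theta>(2,3) by (metis field_class.field_inverse mult.commute mult.right_neutral mult.assoc)
    ultimately show "norm (blinfun_apply f x - (\<Sum>\<gamma>\<in>F. a \<gamma> * T x \<gamma>)) \<le> norm f * e"
      by (simp add: w_def)
  qed
  then show ?thesis by blast
qed

lemma represents_support_countable:
  assumes "represents a M f"
  shows "countable {\<gamma>. a \<gamma> \<noteq> 0}"
proof -
  have "(\<lambda>\<gamma>. norm (a \<gamma>)) summable_on UNIV"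
    by (rule nonneg_bdd_above_summable_on)
      (use represents_sum_le[OF assms] in \<open>auto intro!: bdd_aboveI2\<close>)
  from summable_countable_real[OF this] show ?thesis by simp
qed

text \<open>
  Only countably many coordinates occur in a sequence of coefficient families, so a subsequence
  converges in all coordinates. By the uniform smallness of \<open>T x\<close> off finite sets, the functionals
  then converge pointwise.
\<close>

lemma represents_subseq:
  fixes f :: "nat \<Rightarrow> 'a \<Rightarrow>\<^sub>L 'k" and a :: "nat \<Rightarrow> 'g \<Rightarrow> 'k"
  assumes f: "\<And>n. f n \<in> dual_space scl" and rep: "\<And>n. represents (a n) B (blinfun_apply (f n))"
  shows "\<exists>r b g. strict_mono r \<and> (\<forall>\<gamma>. (\<lambda>n. a (r n) \<gamma>) \<longlonglongrightarrow> b \<gamma>) \<and> g \<in> dual_space scl \<and>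
     represents b B (blinfun_apply g) \<and> (\<forall>x. (\<lambda>n. blinfun_apply (f (r n)) x) \<longlonglongrightarrow> blinfun_apply g x)"
proof -
  have B: "0 \<le> B" using represents_sum_le[OF rep, of "{}"] by simp
  define S where "S = (\<Union>n. {\<gamma>. a n \<gamma> \<noteq> 0})"
  have "countable S" unfolding S_def by (intro countable_UN represents_support_countable[OF rep]) simp
  then obtain h :: "nat \<Rightarrow> 'g" where h: "S \<subseteq> range h"
    by (rule that[OF subset_range_from_nat_into])
  define K where "K = PiE UNIV (\<lambda>_::nat. cball (0::'k) B)"
  have "compactin (product_topology (\<lambda>_. euclidean) UNIV) K"
    unfolding K_def by (subst compactin_PiE) (simp add: compact_cball_scalar)
  then have "compact K" by (simp add: euclidean_product_topology)
  then have "seq_compact K" by (simp add: compact_eq_seq_compact_metric)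
  moreover have "norm (a n \<gamma>) \<le> B" for n \<gamma> using represents_sum_le[OF rep, of "{\<gamma>}"] by simp
  then have "\<forall>n. (\<lambda>i. a n (h i)) \<in> K" by (simp add: K_def PiE_UNIV_domain)
  ultimately obtain l r where r: "strict_mono (r :: nat \<Rightarrow> nat)"
    and lim: "((\<lambda>n. (\<lambda>i. a n (h i))) \<circ> r) \<longlonglongrightarrow> l"
    unfolding seq_compact_def by metis
  have coord: "(\<lambda>n. a (r n) (h i)) \<longlonglongrightarrow> l i" for i
    using continuous_on_tendsto_compose[OF continuous_on_product_coordinates[where i=i] lim] by simp
  have "\<exists>z. (\<lambda>n. a (r n) \<gamma>) \<longlonglongrightarrow> z" for \<gamma>
  proof (cases "\<gamma> \<in> S")
    case True
    then show ?thesis using h coord by blast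
  next
    case False
    then have "a n \<gamma> = 0" for n by (auto simp: S_def)
    then show ?thesis by auto
  qed
  then obtain b where b: "\<And>\<gamma>. (\<lambda>n. a (r n) \<gamma>) \<longlonglongrightarrow> b \<gamma>" by metis
  have part: "(\<lambda>n. \<Sum>\<gamma>\<in>F. a (r n) \<gamma> * T x \<gamma>) \<longlonglongrightarrow> (\<Sum>\<gamma>\<in>F. b \<gamma> * T x \<gamma>)" for F x
    by (intro tendsto_sum tendsto_mult b tendsto_const)
  have "\<exists>z. (\<lambda>n. blinfun_apply (f (r n)) x) \<longlonglongrightarrow> z" for x
  proof -
    have "Cauchy (\<lambda>n. blinfun_apply (f (r n)) x)"
    proof (rule metric_CauchyI)
      fix e :: real assume e: "0 < e"
      define e' where "e' = e / (4 * (B + 1))"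
      have e': "0 < e'" using e B by (simp add: e'_def)
      have "B * e' \<le> (B + 1) * e'" using e' by simp
      also have "\<dots> = e / 4" using B by (simp add: e'_def field_simps)
      finally have Be: "B * e' \<le> e / 4" .
      define F where "F = {\<gamma>. e' \<le> norm (T x \<gamma>)}"
      have F: "finite F" unfolding F_def by (rule T_null[OF e'])
      have err: "norm (blinfun_apply (f n) x - (\<Sum>\<gamma>\<in>F. a n \<gamma> * T x \<gamma>)) \<le> B * e'" for n
        by (rule represents_error[OF rep F]) (use e' in \<open>auto simp: F_def\<close>)
      have "Cauchy (\<lambda>n. \<Sum>\<gamma>\<in>F. a (r n) \<gamma> * T x \<gamma>)" by (rule LIMSEQ_imp_Cauchy[OF part])
      then obtain N where N: "\<And>m n. m \<ge> N \<Longrightarrow> n \<ge> N \<Longrightarrow>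
          dist (\<Sum>\<gamma>\<in>F. a (r m) \<gamma> * T x \<gamma>) (\<Sum>\<gamma>\<in>F. a (r n) \<gamma> * T x \<gamma>) < e / 4"
        using e unfolding Cauchy_def by (metis zero_less_divide_iff zero_less_numeral)
      show "\<exists>N. \<forall>m\<ge>N. \<forall>n\<ge>N. dist (blinfun_apply (f (r m)) x) (blinfun_apply (f (r n)) x) < e"
      proof (intro exI allI impI)
        fix m n assume mn: "N \<le> m" "N \<le> n"
        let ?P = "\<lambda>n. \<Sum>\<gamma>\<in>F. a (r n) \<gamma> * T x \<gamma>"
        have "dist (blinfun_apply (f (r m)) x) (blinfun_apply (f (r n)) x)
          \<le> dist (blinfun_apply (f (r m)) x) (?P m) + dist (?P m) (?P n) + dist (?P n) (blinfun_apply (f (r n)) x)"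
          by (meson add_mono_thms_linordered_semiring(3) dist_triangle order_trans)
        moreover have "dist (blinfun_apply (f (r m)) x) (?P m) \<le> e / 4"
          using err[of "r m"] Be by (simp add: dist_norm)
        moreover have "dist (?P n) (blinfun_apply (f (r n)) x) \<le> e / 4"
          using err[of "r n"] Be by (simp add: dist_norm norm_minus_commute)
        ultimately show "dist (blinfun_apply (f (r m)) x) (blinfun_apply (f (r n)) x) < e"
          using N[OF mn] e by linarith
      qed
    qed
    moreover have "\<forall>n. blinfun_apply (f (r n)) x \<in> cball 0 (B * norm x)"
      using represents_norm_le[OF rep] by simp
    ultimately show ?thesis
      using compact_imp_complete[OF compact_cball_scalar] unfolding complete_def by metis
  qed
  then obtain g where g: "\<And>x. (\<lambda>n. blinfun_apply (f (r n)) x) \<longlonglongrightarrow> g x" by metis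
  have g_le: "norm (g x) \<le> norm x * B" for x
    by (rule LIMSEQ_le_const2[OF tendsto_norm[OF g]])
      (use represents_norm_le[OF rep] in \<open>auto simp: mult.commute\<close>)
  have "bounded_linear g"
  proof (rule bounded_linear_intro[OF _ _ g_le])
    show "g (x + y) = g x + g y" for x y
      by (rule LIMSEQ_unique[OF g[of "x + y", unfolded blinfun.add_right] tendsto_add[OF g g]])
    show "g (c *\<^sub>R x) = c *\<^sub>R g x" for c x
      by (rule LIMSEQ_unique[OF g[of "c *\<^sub>R x", unfolded blinfun.scaleR_right] tendsto_scaleR[OF tendsto_const g]])
  qed
  then have G: "blinfun_apply (Blinfun g) = g" by (rule bounded_linear_Blinfun_apply)
  have "g (scl c x) = c * g x" for c x
    by (rule LIMSEQ_unique[OF g])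
      (use f tendsto_mult[OF tendsto_const g] in \<open>simp add: dual_space_def\<close>)
  then have "Blinfun g \<in> dual_space scl" by (simp add: dual_space_def G)
  moreover have "represents b B g"
    unfolding represents_def
  proof (intro conjI allI impI)
    show "(\<Sum>\<gamma>\<in>F. norm (b \<gamma>)) \<le> B" if "finite F" for F
      by (rule LIMSEQ_le_const2[OF tendsto_sum[OF tendsto_norm[OF b]]])
        (use represents_sum_le[OF rep that] in auto)
    show "norm (g x - (\<Sum>\<gamma>\<in>F. b \<gamma> * T x \<gamma>)) \<le> B * e"
      if "finite F" "0 \<le> e" "\<forall>\<gamma>. \<gamma> \<notin> F \<longrightarrow> norm (T x \<gamma>) \<le> e" for x F e
      by (rule LIMSEQ_le_const2[OF tendsto_norm[OF tendsto_diff[OF g part]]])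
        (use represents_error[OF rep that(1,2)] that(3) in auto)
  qed
  ultimately show ?thesis using r b g G by metis
qed

theorem c0_seq_compact: "seq_compactin (weak_star_topology scl) (dual_ball scl)"
  unfolding seq_compactin_def
proof (intro allI impI)
  fix \<sigma> :: "nat \<Rightarrow> 'a \<Rightarrow>\<^sub>L 'k" assume \<sigma>: "range \<sigma> \<subseteq> dual_ball scl"
  then have D: "\<sigma> n \<in> dual_space scl" and n: "norm (\<sigma> n) \<le> 1" for n by (auto simp: dual_ball_def)
  have "\<exists>a. represents a 1 (blinfun_apply (\<sigma> n))" for n
    using representation[OF D] represents_mono n by blast
  then obtain a where rep: "\<And>n. represents (a n) 1 (blinfun_apply (\<sigma> n))" by metis
  obtain r b g where r: "strict_mono r" and g: "g \<in> dual_space scl" "represents b 1 (blinfun_apply g)"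
    and lim: "\<And>x. (\<lambda>n. blinfun_apply (\<sigma> (r n)) x) \<longlonglongrightarrow> blinfun_apply g x"
    using represents_subseq[of \<sigma> a 1, OF D rep] by blast
  have "norm g \<le> 1" using represents_norm_le[OF g(2)] by (intro norm_blinfun_bound) auto
  with g have "g \<in> dual_ball scl" by (simp add: dual_ball_def)
  moreover have "limitin (weak_star_topology scl) (\<sigma> \<circ> r) g sequentially"
    unfolding limitin_weak_star using g D lim by (simp add: o_def)
  ultimately show "\<exists>l\<in>dual_ball scl. \<exists>r. strict_mono r \<and> limitin (weak_star_topology scl) (\<sigma> \<circ> r) l sequentially"
    using r by blast
qed

section \<open>Asymptotic additivity from coefficients\<close>

text \<open>
  The constant \<open>B\<close> only controls the convergence; the norm is bounded by the total mass of the
  coefficients.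
\<close>

lemma represents_norm_le_Sup:
  assumes rep: "represents a B (blinfun_apply f)"
    and A: "\<And>F. finite F \<Longrightarrow> (\<Sum>\<gamma>\<in>F. norm (a \<gamma>)) \<le> A"
  shows "norm f \<le> A"
proof (rule norm_blinfun_bound)
  show "0 \<le> A" using A[of "{}"] by simp
  have B: "0 \<le> B" using represents_sum_le[OF rep, of "{}"] by simp
  fix x
  show "norm (blinfun_apply f x) \<le> A * norm x"
  proof (rule field_le_epsilon)
    fix e :: real assume e: "0 < e"
    define e' where "e' = e / (B + 1)"
    have e': "0 < e'" using e B by (simp add: e'_def)
    have "B * e' \<le> (B + 1) * e'" using e' by simp
    also have "\<dots> = e" using B by (simp add: e'_def)
    finally have Be: "B * e' \<le> e" .
    define F where "F = {\<gamma>. e' \<le> norm (T x \<gamma>)}"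
    have F: "finite F" unfolding F_def by (rule T_null[OF e'])
    have "norm (blinfun_apply f x - (\<Sum>\<gamma>\<in>F. a \<gamma> * T x \<gamma>)) \<le> B * e'"
      by (rule represents_error[OF rep F]) (use e' in \<open>auto simp: F_def\<close>)
    moreover have "norm (\<Sum>\<gamma>\<in>F. a \<gamma> * T x \<gamma>) \<le> (\<Sum>\<gamma>\<in>F. norm (a \<gamma>) * norm x)"
      by (rule sum_norm_le) (simp add: norm_mult mult_left_mono T_le)
    moreover have "(\<Sum>\<gamma>\<in>F. norm (a \<gamma>) * norm x) \<le> A * norm x"
      unfolding sum_distrib_right[symmetric] by (rule mult_right_mono[OF A[OF F]]) simp
    ultimately show "norm (blinfun_apply f x) \<le> A * norm x + e"
      using norm_triangle_sub[of "blinfun_apply f x" "\<Sum>\<gamma>\<in>F. a \<gamma> * T x \<gamma>"] Be by linarith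
  qed
qed

text \<open>
  If \<open>b\<close> represents \<open>f\<close> and nearly has its total mass on a finite set, then a representation \<open>a\<close>
  of \<open>h\<close> that is close to \<open>b\<close> on this set leaves only the mass \<open>M - norm f\<close>, up to a multiple of
  \<open>\<eta>\<close>, for the difference \<open>h - f\<close>.
\<close>

lemma represents_diff_bound:
  assumes f: "represents b B (blinfun_apply f)" and h: "represents a M (blinfun_apply h)"
    and F0: "finite F0" and \<eta>: "0 < \<eta>"
    and mass: "norm f - \<eta> \<le> (\<Sum>\<gamma>\<in>F0. norm (b \<gamma>))"
    and tail: "\<And>G. finite G \<Longrightarrow> G \<inter> F0 = {} \<Longrightarrow> (\<Sum>\<gamma>\<in>G. norm (b \<gamma>)) \<le> \<eta>"
    and close: "(\<Sum>\<gamma>\<in>F0. norm (a \<gamma> - b \<gamma>)) \<le> \<eta>"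
  shows "norm (h - f) \<le> M - norm f + 4 * \<eta>"
proof (rule norm_blinfun_bound)
  have B: "0 \<le> B" using represents_sum_le[OF f, of "{}"] by simp
  have M: "0 \<le> M" using represents_sum_le[OF h, of "{}"] by simp
  have "norm (b \<gamma>) \<le> norm (a \<gamma>) + norm (a \<gamma> - b \<gamma>)" for \<gamma>
    using norm_triangle_ineq4[of "a \<gamma>" "a \<gamma> - b \<gamma>"] by simp
  then have "(\<Sum>\<gamma>\<in>F0. norm (b \<gamma>)) \<le> (\<Sum>\<gamma>\<in>F0. norm (a \<gamma>) + norm (a \<gamma> - b \<gamma>))"
    by (intro sum_mono)
  then have a0: "norm f - 2 * \<eta> \<le> (\<Sum>\<gamma>\<in>F0. norm (a \<gamma>))"
    using mass close by (simp add: sum.distrib)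
  then show "0 \<le> M - norm f + 4 * \<eta>" using represents_sum_le[OF h F0] \<eta> by linarith
  fix x
  show "norm (blinfun_apply (h - f) x) \<le> (M - norm f + 4 * \<eta>) * norm x"
  proof (rule field_le_epsilon)
    fix e :: real assume e: "0 < e"
    define e' where "e' = e / (B + M + 1)"
    have e': "0 < e'" using e B M by (simp add: e'_def)
    have "(B + M) * e' \<le> (B + M + 1) * e'" using e' by simp
    also have "\<dots> = e" using B M by (simp add: e'_def)
    finally have Be: "B * e' + M * e' \<le> e" by (simp add: distrib_right)
    define F where "F = {\<gamma>. e' \<le> norm (T x \<gamma>)} \<union> F0"
    have F: "finite F" unfolding F_def using T_null[OF e'] F0 by simp
    have off: "norm (T x \<gamma>) \<le> e'" if "\<gamma> \<notin> F" for \<gamma> using that by (simp add: F_def)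
    let ?P = "\<Sum>\<gamma>\<in>F. a \<gamma> * T x \<gamma>" and ?Q = "\<Sum>\<gamma>\<in>F. b \<gamma> * T x \<gamma>"
    have eh: "norm (blinfun_apply h x - ?P) \<le> M * e'"
      by (rule represents_error[OF h F less_imp_le[OF e'] off])
    have ef: "norm (blinfun_apply f x - ?Q) \<le> B * e'"
      by (rule represents_error[OF f F less_imp_le[OF e'] off])
    have split: "sum u F = sum u F0 + sum u (F - F0)" for u :: "'g \<Rightarrow> real"
      using sum.subset_diff[of F0 F u] F by (simp add: F_def add.commute)
    have "(\<Sum>\<gamma>\<in>F. norm (a \<gamma> - b \<gamma>)) \<le> \<eta> + (\<Sum>\<gamma>\<in>F - F0. norm (a \<gamma>) + norm (b \<gamma>))"
      unfolding split[of "\<lambda>\<gamma>. norm (a \<gamma> - b \<gamma>)"]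
      by (intro add_mono close sum_mono norm_triangle_ineq4)
    also have "\<dots> \<le> \<eta> + ((M - (norm f - 2 * \<eta>)) + \<eta>)"
    proof -
      have "(\<Sum>\<gamma>\<in>F - F0. norm (b \<gamma>)) \<le> \<eta>" by (rule tail) (use F in auto)
      then show ?thesis
        using represents_sum_le[OF h F] a0
        unfolding split[of "\<lambda>\<gamma>. norm (a \<gamma>)"] sum.distrib by linarith
    qed
    finally have ab: "(\<Sum>\<gamma>\<in>F. norm (a \<gamma> - b \<gamma>)) \<le> M - norm f + 4 * \<eta>" by simp
    have "norm (?P - ?Q) \<le> (\<Sum>\<gamma>\<in>F. norm (a \<gamma> - b \<gamma>) * norm x)"
      unfolding sum_subtractf[symmetric] left_diff_distrib[symmetric]
      by (rule sum_norm_le) (simp add: norm_mult mult_left_mono T_le)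
    also have "\<dots> \<le> (M - norm f + 4 * \<eta>) * norm x"
      unfolding sum_distrib_right[symmetric] by (rule mult_right_mono[OF ab]) simp
    finally have PQ: "norm (?P - ?Q) \<le> (M - norm f + 4 * \<eta>) * norm x" .
    have eq: "blinfun_apply (h - f) x = (blinfun_apply h x - ?P) - (blinfun_apply f x - ?Q) + (?P - ?Q)"
      by (simp add: blinfun.diff_left)
    have "norm (blinfun_apply (h - f) x)
        \<le> norm (blinfun_apply h x - ?P) + norm (blinfun_apply f x - ?Q) + norm (?P - ?Q)"
      unfolding eq by (rule order_trans[OF norm_triangle_ineq add_right_mono[OF norm_triangle_ineq4]])
    then show "norm (blinfun_apply (h - f) x) \<le> (M - norm f + 4 * \<eta>) * norm x + e"
      using eh ef PQ Be by linarith
  qed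
qed

text \<open>
  For a weak* null sequence \<open>t\<close>, the functionals \<open>f + t n\<close> are represented with their norms as
  constants. A coordinatewise limit of the representing families represents \<open>f\<close>, so the norm of
  \<open>f + t n\<close> splits into the mass near the limit, which is at least \<open>norm f\<close>, and the remaining mass, which
  bounds the norm of \<open>t n\<close>.
\<close>

theorem c0_m1_star: "property_m1_star scl"
proof (rule asymp_additive_imp_m1_star, rule ccontr)
  fix f t M and e :: real
  assume f: "f \<in> dual_space scl" and tD: "\<And>n. t n \<in> dual_space scl" and tb: "\<And>n. norm (t n) \<le> M"
    and t0: "\<And>x. (\<lambda>n. blinfun_apply (t n) x) \<longlonglongrightarrow> 0" and e: "e > 0"
    and "\<not> (\<forall>\<^sub>F n in sequentially. norm f + norm (t n) - e \<le> norm (f + t n))"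
  then obtain r0 :: "nat \<Rightarrow> nat" where r0: "strict_mono r0"
    and nle: "\<forall>n. \<not> norm f + norm (t (r0 n)) - e \<le> norm (f + t (r0 n))"
    using not_eventually_sequentiallyD[of "\<lambda>n. norm f + norm (t n) - e \<le> norm (f + t n)"] by blast
  define h where "h n = f + t (r0 n)" for n
  have hD: "h n \<in> dual_space scl" for n unfolding h_def by (rule dual_space_add[OF f tD])
  have hb: "norm (h n) \<le> norm f + M" for n
    using norm_triangle_ineq[of f "t (r0 n)"] tb[of "r0 n"] by (simp add: h_def)
  have h_lim: "(\<lambda>n. blinfun_apply (h n) x) \<longlonglongrightarrow> blinfun_apply f x" for x
    using tendsto_add[OF tendsto_const LIMSEQ_subseq_LIMSEQ[OF t0 r0], of "blinfun_apply f x"]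
    by (simp add: h_def blinfun.add_left o_def)
  obtain a where rep: "\<And>n. represents (a n) (norm (h n)) (blinfun_apply (h n))"
    using representation[OF hD] by metis
  have "represents (a n) (norm f + M) (blinfun_apply (h n))" for n
    by (rule represents_mono[OF rep hb])
  from represents_subseq[of h a, OF hD this]
  obtain r b g where r: "strict_mono r" and ab: "\<And>\<gamma>. (\<lambda>n. a (r n) \<gamma>) \<longlonglongrightarrow> b \<gamma>"
    and g: "represents b (norm f + M) (blinfun_apply g)"
    and lim: "\<And>x. (\<lambda>n. blinfun_apply (h (r n)) x) \<longlonglongrightarrow> blinfun_apply g x" by blast
  have "g = f"
  proof (rule blinfun_eqI)
    show "blinfun_apply g x = blinfun_apply f x" for x
      using LIMSEQ_unique[OF lim LIMSEQ_subseq_LIMSEQ[OF h_lim r, unfolded o_def]] .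
  qed
  note f_rep = g[unfolded this]
  define A where "A = (SUP F\<in>{F. finite F}. \<Sum>\<gamma>\<in>F. norm (b \<gamma>))"
  have A: "(\<Sum>\<gamma>\<in>F. norm (b \<gamma>)) \<le> A" if "finite F" for F
    unfolding A_def
    by (rule cSUP_upper) (use that represents_sum_le[OF f_rep] in \<open>auto intro!: bdd_aboveI2\<close>)
  define \<eta> where "\<eta> = e / 4"
  have \<eta>: "\<eta> > 0" using e by (simp add: \<eta>_def)
  have "\<exists>F0\<in>{F. finite F}. A - \<eta> < (\<Sum>\<gamma>\<in>F0. norm (b \<gamma>))"
    unfolding A_def
    by (subst less_cSUP_iff[symmetric])
      (use \<eta> represents_sum_le[OF f_rep] in \<open>auto intro!: bdd_aboveI2\<close>)
  then obtain F0 where F0: "finite F0" "A - \<eta> < (\<Sum>\<gamma>\<in>F0. norm (b \<gamma>))" by blast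
  have mass: "norm f - \<eta> \<le> (\<Sum>\<gamma>\<in>F0. norm (b \<gamma>))"
    using F0(2) represents_norm_le_Sup[OF f_rep A] by simp
  have tail: "(\<Sum>\<gamma>\<in>G. norm (b \<gamma>)) \<le> \<eta>" if "finite G" "G \<inter> F0 = {}" for G
    using A[of "G \<union> F0"] F0 that by (simp add: sum.union_disjoint)
  have "(\<lambda>n. \<Sum>\<gamma>\<in>F0. norm (a (r n) \<gamma> - b \<gamma>)) \<longlonglongrightarrow> (\<Sum>\<gamma>\<in>F0. 0)"
    by (intro tendsto_sum tendsto_norm_zero LIM_zero ab)
  then have "\<forall>\<^sub>F n in sequentially. (\<Sum>\<gamma>\<in>F0. norm (a (r n) \<gamma> - b \<gamma>)) < \<eta>"
    using \<eta> by (intro order_tendstoD(2)) auto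
  then obtain n where "(\<Sum>\<gamma>\<in>F0. norm (a (r n) \<gamma> - b \<gamma>)) \<le> \<eta>"
    unfolding eventually_sequentially by (meson less_imp_le order_refl)
  from represents_diff_bound[OF f_rep rep F0(1) \<eta> mass tail this]
  have "norm (t (r0 (r n))) \<le> norm (f + t (r0 (r n))) - norm f + e" by (simp add: h_def \<eta>_def)
  with nle[rule_format, of "r n"] show False by simp
qed

end

lemma isometric_to_subspace_c0_embedding:
  fixes scl :: "'k::real_or_complex \<Rightarrow> 'a::banach \<Rightarrow> 'a" and \<Gamma> :: "'g set"
  assumes "banach_space_over scl" and "isometric_to_subspace_c0 scl \<Gamma>"
  shows "\<exists>T :: 'a \<Rightarrow> 'g \<Rightarrow> 'k. c0_embedding scl T"
proof -
  obtain T :: "'a \<Rightarrow> 'g \<Rightarrow> 'k" where T: "range T \<subseteq> c0_space \<Gamma>" "\<forall>x y. T (x + y) = (\<lambda>\<gamma>. T x \<gamma> + T y \<gamma>)"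
      "\<forall>c x. T (scl c x) = (\<lambda>\<gamma>. c * T x \<gamma>)" "\<forall>x. c0_norm \<Gamma> (T x) = norm x"
    using assms(2) unfolding isometric_to_subspace_c0_def by blast
  have out: "T x \<gamma> = 0" if "\<gamma> \<notin> \<Gamma>" for x \<gamma> using T(1) that by (auto simp: c0_space_def)
  have fin: "finite {\<gamma>\<in>\<Gamma>. e \<le> norm (T x \<gamma>)}" if "e > 0" for e x
    using T(1) that by (auto simp: c0_space_def)
  have bdd: "bdd_above (insert 0 ((\<lambda>\<gamma>. norm (T x \<gamma>)) ` \<Gamma>))" for x
  proof -
    have "(\<lambda>\<gamma>. norm (T x \<gamma>)) ` \<Gamma> \<subseteq> {..1} \<union> (\<lambda>\<gamma>. norm (T x \<gamma>)) ` {\<gamma>\<in>\<Gamma>. 1 \<le> norm (T x \<gamma>)}"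
      by force
    moreover have "bdd_above ({..1} \<union> (\<lambda>\<gamma>. norm (T x \<gamma>)) ` {\<gamma>\<in>\<Gamma>. 1 \<le> norm (T x \<gamma>)})"
      using fin[of 1 x] by (simp add: bdd_above_finite)
    ultimately show ?thesis using bdd_above_mono by (metis bdd_above_insert)
  qed
  have nrm: "norm x = Sup (insert 0 ((\<lambda>\<gamma>. norm (T x \<gamma>)) ` \<Gamma>))" for x
    using T(4) by (simp add: c0_norm_def)
  have "c0_embedding scl T"
  proof (rule c0_embedding.intro[OF assms(1)], unfold_locales)
    show "finite {\<gamma>. e \<le> norm (T x \<gamma>)}" if "e > 0" for e x
    proof (rule finite_subset[OF _ fin[OF that]])
      show "{\<gamma>. e \<le> norm (T x \<gamma>)} \<subseteq> {\<gamma>\<in>\<Gamma>. e \<le> norm (T x \<gamma>)}" using out[of _ x] that by force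
    qed
    show "norm (T x \<gamma>) \<le> norm x" for x \<gamma>
      unfolding nrm[of x]
      by (cases "\<gamma> \<in> \<Gamma>") (use bdd out in \<open>auto intro!: cSup_upper\<close>)
    show "norm x \<le> b" if "0 \<le> b" "\<And>\<gamma>. norm (T x \<gamma>) \<le> b" for b x
      unfolding nrm[of x] by (rule cSup_least) (use that in auto)
  qed (use T in auto)
  then show ?thesis by blast
qed

section \<open>Schur properties of the dual space\<close>

theorem corollary6p6:
  fixes scl :: "'k::real_or_complex \<Rightarrow> 'a::banach \<Rightarrow> 'a" and \<Gamma> :: "'g set"
  assumes "banach_space_over scl"
  shows "(property_m1_star scl \<and> seq_compactin (weak_star_topology scl) (dual_ball scl) \<longrightarrow>
            one_Schur (dual_space scl) dual_scl \<and>
            one_strong_Schur (dual_space scl) dual_scl) \<and>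
         (isometric_to_subspace_c0 scl \<Gamma> \<longrightarrow>
            property_m1_star scl \<and> seq_compactin (weak_star_topology scl) (dual_ball scl))"
proof (intro conjI impI)
  assume "isometric_to_subspace_c0 scl \<Gamma>"
  then obtain T :: "'a \<Rightarrow> 'g \<Rightarrow> 'k" where "c0_embedding scl T"
    using isometric_to_subspace_c0_embedding[OF assms] by blast
  then show "property_m1_star scl" and "seq_compactin (weak_star_topology scl) (dual_ball scl)"
    by (rule c0_embedding.c0_m1_star, rule c0_embedding.c0_seq_compact)
qed (use assms m1_star_imp_one_Schur m1_star_imp_one_strong_Schur in blast)+

end
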